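(* Let $\mathbb{F}_q$ be a finite field with $q=p^k$ elements ($p$ prime, $k\ge1$) and $q\equiv 1\pmod 3$, and let $z\in\mathbb{F}_q^{\ast}$ be non-cubic. For $n\ge 0$ let $B_n(z)$ denote the number of $(x_1,\dots,x_{n+1})\in\mathbb{F}_q^{n+1}$ with $x_1^3+x_2^3+\cdots+x_n^3+zx_{n+1}^3=0$. Then, as formal power series in $x$, $$\sum_{n=0}^{\infty}B_n(z)x^n=\frac{1}{1-qx}-\frac{(q-1)x+\frac{1}{2}(q-1)(c-9d)x^2}{1-3qx^2-qcx^3},$$ where $c,d$ are the integers uniquely determined by $$4q=c^2+27d^2,\quad c\equiv 1\pmod 3,\quad (c,p)=1 \text{ if } p\equiv 1\pmod 3,\quad 9d\equiv c\left(2z^{\frac{q-1}{3}}+1\right)\pmod p,$$ where $z^{(q-1)/3}\in\mathbb{F}_q$ is a cube root of unity lying in $\mathbb{F}_p$, identified with an integer residue mod $p$.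
   Context: An element $z\in\mathbb{F}_q^{\ast}$ is called cubic if $z=y^3$ for some $y\in\mathbb{F}_q^{\ast}$, and non-cubic otherwise.
   Formalization: That z^((q-1)/3) lies in F_p is claimed only for p ≡ 1 (mod 3), since it fails for p ≡ 2 (mod 3) (e.g. q = 4); the congruence 9d ≡ c(2z^((q-1)/3)+1) (mod p) is read as an equation in F_q, so the theorem still covers all p. *)

theory Defs
  imports
    "HOL-Library.Cardinality"
    "HOL-Library.FuncSet"
    "HOL-Computational_Algebra.Computational_Algebra"
    "HOL-Number_Theory.Number_Theory"
begin

definition cubic :: "'a::field \<Rightarrow> bool" where
  "cubic z \<longleftrightarrow> (\<exists>y. y \<noteq> 0 \<and> z = y ^ 3)"

definition B :: "nat \<Rightarrow> 'a::{field,finite} \<Rightarrow> nat" where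
  "B n z = card {x \<in> {1..n+1} \<rightarrow>\<^sub>E (UNIV :: 'a set).
                   (\<Sum>i=1..n. x i ^ 3) + z * x (n+1) ^ 3 = 0}"

text \<open>
  The congruence \<open>9 d \<equiv> c (2 z^((q-1)/3) + 1) (mod p)\<close> involves a field element, so it is
  stated in the field, of characteristic \<open>p\<close>: the identification of integer residues mod \<open>p\<close>
  with elements of the prime field is \<^const>\<open>of_int\<close>. For \<open>p \<equiv> 2 (mod 3)\<close>, where
  \<open>z^((q-1)/3)\<close> is not in the prime field if \<open>z\<close> is non-cubic, the remaining conditions
  give \<open>d = 0\<close> and \<open>p dvd c\<close>, and the equation reads \<open>0 = 0\<close>.
\<close>

definition is_cd :: "nat \<Rightarrow> 'a::{field,finite} \<Rightarrow> int \<Rightarrow> int \<Rightarrow> bool" where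
  "is_cd p z c d \<longleftrightarrow>
     4 * int CARD('a) = c\<^sup>2 + 27 * d\<^sup>2 \<and>
     [c = 1] (mod 3) \<and>
     ([p = 1] (mod 3) \<longrightarrow> coprime c (int p)) \<and>
     of_int (9 * d) = of_int c * (2 * z ^ ((CARD('a) - 1) div 3) + 1)"

end

theory Submission
  imports Defs
begin

text \<open>
  Let \<open>T\<^sub>i\<close> act on rational-valued functions on the field by
  \<open>(T\<^sub>i g)(a) = \<Sum>x. g (a - z\<^sup>i x\<^sup>3)\<close>, so that \<open>B\<^sub>n(z) = (T\<^sub>1 T\<^sub>0\<^sup>n \<delta>\<^sub>0)(0)\<close>.
  On functions of sum zero, \<open>T\<^sub>0 + T\<^sub>1 + T\<^sub>2 = 0\<close> and the products \<open>T\<^sub>i T\<^sub>j\<close> are combinations of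
  \<open>1, T\<^sub>0, T\<^sub>1, T\<^sub>2\<close> whose coefficients come from the numbers \<open>N(z\<^sup>i)\<close> of solutions of
  \<open>x\<^sup>3 + y\<^sup>3 = z\<^sup>i\<close>. Associativity then forces \<open>4 q = c\<^sup>2 + 27 d\<^sup>2\<close> for \<open>c = N(1) - q + 2\<close> and
  \<open>9 d = N(z) - N(z\<^sup>2)\<close>, and \<open>T\<^sub>0\<^sup>3 = 3 q T\<^sub>0 + q c\<close>, which is the recurrence behind the generating
  function. Since \<open>t\<close> has \<open>1 + t\<^sup>f + t\<^sup>2\<^sup>f\<close> cube roots modulo \<open>p\<close>, where \<open>f = (q - 1) / 3\<close>, power
  sums give \<open>N(b) \<equiv> - 2 - (2f choose f) b\<^sup>f\<close>, hence the congruence between \<open>c\<close> and \<open>d\<close>; by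
  Lucas, \<open>p\<close> does not divide the binomial coefficient if \<open>p \<equiv> 1 (mod 3)\<close>.
\<close>

section \<open>Sums over finite fields\<close>

lemma sum_fibre_card:
  fixes h :: "'b::finite \<Rightarrow> 'c::finite" and g :: "'c \<Rightarrow> 'd::comm_semiring_1"
  shows "(\<Sum>x\<in>UNIV. g (h x)) = (\<Sum>t\<in>UNIV. of_nat (card {x. h x = t}) * g t)"
proof -
  have "(\<Sum>x\<in>UNIV. g (h x)) = (\<Sum>t\<in>UNIV. \<Sum>x\<in>{x\<in>UNIV. h x = t}. g (h x))"
    by (rule sum.group[symmetric]) auto
  also have "\<dots> = (\<Sum>t\<in>UNIV. of_nat (card {x. h x = t}) * g t)"
    by (intro sum.cong) (auto simp: sum_constant)
  finally show ?thesis .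
qed

lemma sum_UNIV_translate:
  fixes g :: "'a::{ab_group_add,finite} \<Rightarrow> 'b::comm_monoid_add"
  shows "(\<Sum>a\<in>UNIV. g (a - b)) = (\<Sum>a\<in>UNIV. g a)"
  by (rule sum.reindex_bij_witness[of _ "\<lambda>a. a + b" "\<lambda>a. a - b"]) auto

lemma sum_UNIV_reflect:
  fixes g :: "'a::{ab_group_add,finite} \<Rightarrow> 'b::comm_monoid_add"
  shows "(\<Sum>a\<in>UNIV. g (b - a)) = (\<Sum>a\<in>UNIV. g a)"
  by (rule sum.reindex_bij_witness[of _ "\<lambda>a. b - a" "\<lambda>a. b - a"]) auto

lemma sum_UNIV_scale:
  fixes g :: "'a::{field,finite} \<Rightarrow> 'b::comm_monoid_add"
  assumes "c \<noteq> 0"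
  shows "(\<Sum>a\<in>UNIV. g (c * a)) = (\<Sum>a\<in>UNIV. g a)"
  by (rule sum.reindex_bij_witness[of _ "\<lambda>a. a / c" "\<lambda>a. c * a"]) (use assms in auto)

lemma fermat_finite_field:
  fixes a :: "'a::{field,finite}"
  assumes "a \<noteq> 0"
  shows "a ^ (CARD('a) - 1) = 1"
proof -
  let ?U = "UNIV - {0::'a}"
  have "(\<Prod>x\<in>?U. x) = (\<Prod>x\<in>?U. a * x)"
    by (rule prod.reindex_bij_witness[of _ "\<lambda>x. a * x" "\<lambda>x. x / a"]) (use assms in auto)
  also have "\<dots> = a ^ card ?U * (\<Prod>x\<in>?U. x)"
    by (simp add: prod.distrib)
  finally have "a ^ card ?U = 1" by auto
  then show ?thesis by (simp add: card_Diff_singleton)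
qed

lemma card_nth_roots_le:
  fixes c :: "'a::field"
  assumes "n > 0"
  shows "card {x. x ^ n = c} \<le> n"
proof -
  let ?P = "Polynomial.monom 1 n - [:c:]"
  have "Polynomial.coeff ?P n = 1" using assms by (cases n) auto
  hence "?P \<noteq> 0" by (metis Polynomial.coeff_0 zero_neq_one)
  moreover have "{x. x ^ n = c} = {x. poly ?P x = 0}" by (simp add: Polynomial.poly_monom)
  moreover have "degree ?P \<le> n"
    by (intro degree_diff_le) (auto simp: Polynomial.degree_monom_le)
  ultimately show ?thesis using card_poly_roots_bound[of ?P] by simp
qed

lemma CARD_field_gt_1: "CARD('a::{field,finite}) > 1"
proof -
  have "card {0::'a, 1} \<le> CARD('a)" by (rule card_mono) auto
  thus ?thesis by simp
qed

text \<open>As \<open>t ^ m = 1\<close> has at most \<open>m\<close> roots, some nonzero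
  \<open>g\<close> has \<open>g ^ m \<noteq> 1\<close>; substituting \<open>g * t\<close> for
  \<open>t\<close> multiplies the sum by \<open>g ^ m\<close>. For \<open>m = 0\<close> the sum is
  q, which is zero in the field.\<close>

lemma sum_power_eq_0:
  fixes m :: nat
  assumes "m < CARD('a::{field,finite}) - 1"
  shows "(\<Sum>t\<in>UNIV. (t::'a) ^ m) = 0"
proof (cases "m = 0")
  case True
  then show ?thesis using CHAR_dvd_CARD[where 'a='a] by (simp add: of_nat_eq_0_iff_char_dvd)
next
  case False
  have "\<exists>g::'a. g \<noteq> 0 \<and> g ^ m \<noteq> 1"
  proof (rule ccontr)
    assume "\<not> ?thesis"
    hence "UNIV - {0::'a} \<subseteq> {x. x ^ m = 1}" by auto
    hence "card (UNIV - {0::'a}) \<le> card {x::'a. x ^ m = 1}" by (intro card_mono) auto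
    also have "\<dots> \<le> m" using False by (intro card_nth_roots_le) auto
    finally show False using assms by (simp add: card_Diff_singleton)
  qed
  then obtain g :: 'a where g: "g \<noteq> 0" "g ^ m \<noteq> 1" by blast
  have "(\<Sum>t\<in>UNIV. (t::'a) ^ m) = (\<Sum>t\<in>UNIV. (g * t) ^ m)"
    using sum_UNIV_scale[OF g(1), of "\<lambda>t. t ^ m"] by simp
  also have "\<dots> = g ^ m * (\<Sum>t\<in>UNIV. (t::'a) ^ m)"
    by (simp add: power_mult_distrib sum_distrib_left)
  finally show ?thesis using g by (metis mult_cancel_right1)
qed

text \<open>The condition \<open>m > 0\<close> makes \<open>t = 0\<close> contribute nothing on
  either side; elsewhere Fermat applies.\<close>

lemma sum_power_shift:
  assumes "m > 0"
  shows "(\<Sum>t\<in>UNIV. (t::'a::{field,finite}) ^ (m + (CARD('a) - 1))) = (\<Sum>t\<in>UNIV. t ^ m)"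
proof (rule sum.cong)
  fix t :: 'a
  show "t ^ (m + (CARD('a) - 1)) = t ^ m"
    using fermat_finite_field[of t] assms
    by (cases "t = 0") (simp_all only: power_add zero_power mult_zero_left mult_1_right not_False_eq_True)
qed simp

lemma sum_power_CARD_minus_1:
  "(\<Sum>t\<in>UNIV. (t::'a::{field,finite}) ^ (CARD('a) - 1)) = -1"
proof -
  have q: "CARD('a) - 1 > 0" 
    using CARD_field_gt_1[where 'a='a] by simp
  have "(\<Sum>t\<in>UNIV. (t::'a) ^ (CARD('a) - 1)) = (\<Sum>t\<in>UNIV - {0::'a}. t ^ (CARD('a) - 1))"
    using q by (subst sum.remove[of _ 0]) auto
  also have "\<dots> = (\<Sum>t\<in>UNIV - {0::'a}. 1)"
    by (intro sum.cong) (auto simp: fermat_finite_field[simplified])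
  also have "\<dots> = of_nat (CARD('a) - 1)"
    by (simp add: card_Diff_singleton)
  also have "\<dots> = of_nat CARD('a) - 1"
    using q by (subst of_nat_diff) auto
  also have "(of_nat CARD('a) :: 'a) = 0"
    using CHAR_dvd_CARD[where 'a='a] by (simp add: of_nat_eq_0_iff_char_dvd)
  finally show ?thesis by simp
qed

text \<open>Compare coefficients in \<open>(1 + X)^(p N + b) = (1 + X^p)^N (1 + X)^b\<close>, which
  holds in characteristic p. An exponent \<open>p i + j\<close> with \<open>j < p\<close> determines
  \<open>i\<close> and \<open>j\<close>, so a single term survives.\<close>

lemma lucas_step:
  fixes N K b d :: nat
  assumes p: "prime CHAR('a::comm_ring_1)" and b: "b < CHAR('a)" and d: "d < CHAR('a)"
  shows "(of_nat ((CHAR('a) * N + b) choose (CHAR('a) * K + d)) :: 'a) = of_nat (N choose K) * of_nat (b choose d)"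
proof -
  let ?p = "CHAR('a)"
  let ?X = "Polynomial.monom (1::'a) 1"
  have binom: "(1 + Y) ^ n = (\<Sum>i\<le>n. of_nat (n choose i) * Y ^ i)" for Y :: "'a poly" and n
    using binomial_ring[of Y 1 n] by (simp add: add.commute)
  have "(1 + ?X) ^ (?p * N + b) = ((1 + ?X) ^ ?p) ^ N * (1 + ?X) ^ b"
    by (simp add: power_add power_mult)
  also have "(1 + ?X) ^ ?p = 1 + ?X ^ ?p"
    by (subst freshmans_dream) (simp_all only: semiring_char_poly power_one p)
  also have "(1 + ?X ^ ?p) ^ N * (1 + ?X) ^ b =
     (\<Sum>i\<le>N. \<Sum>j\<le>b. Polynomial.monom (of_nat (N choose i) * of_nat (b choose j)) (?p * i + j))"
    by (simp only: binom sum_product of_nat_monom Polynomial.monom_power Polynomial.mult_monom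
        power_one mult_1_right mult_1_left add_0_left add_0_right)
  finally have eq: "(1 + ?X) ^ (?p * N + b) = \<dots>" .
  have "(1 + ?X) ^ n = (\<Sum>i\<le>n. Polynomial.monom (of_nat (n choose i)) i)" for n
    by (simp only: binom of_nat_monom Polynomial.monom_power Polynomial.mult_monom
        power_one mult_1_right mult_1_left add_0_left add_0_right)
  hence c: "Polynomial.coeff ((1 + ?X) ^ n) m = of_nat (n choose m)" for n m
    by (auto simp: coeff_sum binomial_eq_0)
  have inj: "?p * i + j = ?p * K + d \<longleftrightarrow> i = K \<and> j = d" if "j \<le> b" for i j
  proof
    assume e: "?p * i + j = ?p * K + d"
    have "j < ?p" using that b by simp
    hence "(?p * i + j) div ?p = i" "(?p * i + j) mod ?p = j" by auto
    moreover have "(?p * K + d) div ?p = K" "(?p * K + d) mod ?p = d" using d by auto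
    ultimately show "i = K \<and> j = d" using e by metis
  qed auto
  have "of_nat ((?p * N + b) choose (?p * K + d)) = Polynomial.coeff ((1 + ?X) ^ (?p * N + b)) (?p * K + d)"
    by (rule c[symmetric])
  also have "\<dots> = (\<Sum>i\<le>N. \<Sum>j\<le>b. if i = K \<and> j = d then of_nat (N choose i) * of_nat (b choose j) else 0)"
    unfolding eq coeff_sum by (intro sum.cong) (auto simp: inj)
  also have "\<dots> = (\<Sum>i\<le>N. if i = K then (\<Sum>j\<le>b. if j = d then of_nat (N choose i) * of_nat (b choose j) else 0) else 0)"
    by (intro sum.cong) auto
  also have "\<dots> = of_nat (N choose K) * of_nat (b choose d)"
    by (auto simp: not_le binomial_eq_0)
  finally show ?thesis .
qed

text \<open>In base p all \<open>k\<close> digits of \<open>f\<close> are \<open>g\<close> and those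
  of \<open>2 f\<close> are \<open>2 g < p\<close>. Each use of \<open>lucas_step\<close> splits off
  a factor \<open>2 g choose g\<close>, a divisor of \<open>fact (2 * g)\<close> and hence prime to
  p.\<close>

lemma central_binomial_nonzero:
  assumes p: "prime CHAR('a::field)" and g: "CHAR('a) = 3 * g + 1" and f: "CHAR('a) ^ k = 3 * f + 1"
  shows "(of_nat ((2 * f) choose f) :: 'a) \<noteq> 0"
  using f
proof (induction k arbitrary: f)
  case 0
  then show ?case by simp
next
  case (Suc k)
  let ?p = "CHAR('a)"
  have "[?p ^ k = 1 ^ k] (mod 3)"
    by (intro cong_pow) (simp add: g cong_def)
  then have "(?p ^ k) mod 3 = 1" by (simp add: cong_def)
  then obtain f' where f': "?p ^ k = 3 * f' + 1"
    by (metis div_mult_mod_eq mult.commute)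
  have "3 * f + 1 = ?p * (3 * f' + 1)" using Suc.prems f' by simp
  hence "f = ?p * f' + g" using g by (simp add: algebra_simps)
  hence e: "f = ?p * f' + g" "2 * f = ?p * (2 * f') + 2 * g" by auto
  have "of_nat ((2 * g) choose g) \<noteq> (0 :: 'a)"
  proof
    assume "of_nat ((2 * g) choose g) = (0 :: 'a)"
    hence "?p dvd (2 * g) choose g" by (simp add: of_nat_eq_0_iff_char_dvd)
    hence "?p dvd fact (2 * g)"
      using binomial_fact_lemma[of g "2 * g"] by (metis dvd_mult le_add2 mult_2)
    thus False using p g by (simp add: prime_dvd_fact_iff)
  qed
  then show ?case using Suc.IH[OF f'] g
    unfolding e(2) by (subst e(1), subst lucas_step[OF p]) auto
qed

section \<open>Representations by cubes\<close>

definition cube_roots :: "'a::{field,finite} \<Rightarrow> nat" where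
  "cube_roots t = card {x. x ^ 3 = t}"

text \<open>This is N(b) of the overview, written as a convolution of \<open>cube_roots\<close> with
  itself.\<close>

definition two_cubes :: "'a::{field,finite} \<Rightarrow> nat" where
  "two_cubes b = (\<Sum>t\<in>UNIV. cube_roots t * cube_roots (b - t))"

text \<open>Rational values allow the divisions by 2, 3 and q that occur below.\<close>

definition shift_cubes :: "'a::{field,finite} \<Rightarrow> ('a \<Rightarrow> rat) \<Rightarrow> 'a \<Rightarrow> rat" where
  "shift_cubes s g a = (\<Sum>x\<in>UNIV. g (a - s * x ^ 3))"

lemma sum_over_cubes:
  fixes g :: "'a::{field,finite} \<Rightarrow> 'b::comm_semiring_1"
  shows "(\<Sum>x\<in>UNIV. g (x ^ 3)) = (\<Sum>t\<in>UNIV. of_nat (cube_roots t) * g t)"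
  unfolding cube_roots_def by (rule sum_fibre_card)

lemma cube_roots_0 [simp]: "cube_roots (0::'a::{field,finite}) = 1"
proof -
  have "{x::'a. x ^ 3 = 0} = {0}" by auto
  thus ?thesis by (simp add: cube_roots_def)
qed

lemma cube_roots_mult_cube:
  fixes y :: "'a::{field,finite}"
  assumes "y \<noteq> 0"
  shows "cube_roots (y ^ 3 * t) = cube_roots t"
  unfolding cube_roots_def
  by (rule bij_betw_same_card[of "\<lambda>x. x / y"],
      rule bij_betw_byWitness[of _ "\<lambda>x. y * x"])
     (use assms in \<open>auto simp: power_divide power_mult_distrib\<close>)

lemma cube_roots_uminus: "cube_roots (- t) = cube_roots (t :: 'a::{field,finite})"
  using cube_roots_mult_cube[of "-1" t] by simp

lemma two_cubes_mult_cube: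
  fixes y :: "'a::{field,finite}"
  assumes "y \<noteq> 0"
  shows "two_cubes (y ^ 3 * b) = two_cubes b"
proof -
  have "two_cubes (y ^ 3 * b) = (\<Sum>t\<in>UNIV. cube_roots (y ^ 3 * t) * cube_roots (y ^ 3 * b - y ^ 3 * t))"
    unfolding two_cubes_def
    using sum_UNIV_scale[of "y ^ 3" "\<lambda>t. cube_roots t * cube_roots (y ^ 3 * b - t)"] assms by simp
  also have "\<dots> = two_cubes b"
    by (simp add: two_cubes_def cube_roots_mult_cube[OF assms] flip: right_diff_distrib)
  finally show ?thesis .
qed

lemma sum_cube_roots: "(\<Sum>t\<in>(UNIV::'a::{field,finite} set). cube_roots t) = CARD('a)"
  using sum_over_cubes[of "\<lambda>_::'a. 1::nat"] by simp

lemma sum_two_cubes: "(\<Sum>b\<in>(UNIV::'a::{field,finite} set). two_cubes b) = CARD('a)\<^sup>2"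
proof -
  have "(\<Sum>b\<in>(UNIV::'a set). two_cubes b)
      = (\<Sum>t\<in>(UNIV::'a set). cube_roots t * (\<Sum>b\<in>UNIV. cube_roots (b - t)))"
    unfolding two_cubes_def by (subst sum.swap) (simp add: sum_distrib_left)
  also have "\<dots> = CARD('a)\<^sup>2"
    by (simp add: sum_UNIV_translate sum_cube_roots power2_eq_square flip: sum_distrib_right)
  finally show ?thesis .
qed

lemma sum_over_two_cubes:
  fixes g :: "'a::{field,finite} \<Rightarrow> 'b::comm_semiring_1"
  shows "(\<Sum>x\<in>UNIV. \<Sum>y\<in>UNIV. g (x ^ 3 + y ^ 3)) = (\<Sum>b\<in>UNIV. of_nat (two_cubes b) * g b)"
proof -
  have "(\<Sum>x\<in>UNIV. \<Sum>y\<in>UNIV. g (x ^ 3 + y ^ 3))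
      = (\<Sum>t\<in>UNIV. of_nat (cube_roots t) * (\<Sum>y\<in>UNIV. g (t + y ^ 3)))"
    by (rule sum_over_cubes[of "\<lambda>t. \<Sum>y\<in>UNIV. g (t + y ^ 3)"])
  also have "\<dots> = (\<Sum>t\<in>UNIV. of_nat (cube_roots t) * (\<Sum>s\<in>UNIV. of_nat (cube_roots s) * g (t + s)))"
    by (simp only: sum_over_cubes[of "\<lambda>s. g (t + s)" for t])
  also have "\<dots> = (\<Sum>t\<in>UNIV. of_nat (cube_roots t) * (\<Sum>b\<in>UNIV. of_nat (cube_roots (b - t)) * g b))"
  proof -
    have "(\<Sum>s\<in>UNIV. of_nat (cube_roots s) * g (t + s)) = (\<Sum>b\<in>UNIV. of_nat (cube_roots (b - t)) * g b)" for t
      using sum_UNIV_translate[of "\<lambda>s. of_nat (cube_roots s) * g (t + s)" t] by simp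
    thus ?thesis by simp
  qed
  also have "\<dots> = (\<Sum>b\<in>UNIV. of_nat (two_cubes b) * g b)"
    by (simp add: two_cubes_def sum_distrib_left sum_distrib_right mult.assoc) (rule sum.swap)
  finally show ?thesis .
qed

lemma shift_cubes_add: "shift_cubes s (\<lambda>a. g a + h a) a = shift_cubes s g a + shift_cubes s h a"
  by (simp add: shift_cubes_def sum.distrib)

lemma shift_cubes_cmult: "shift_cubes s (\<lambda>a. k * g a) a = k * shift_cubes s g a"
  by (simp add: shift_cubes_def sum_distrib_left)

lemma shift_cubes_commute: "shift_cubes s (shift_cubes t g) = shift_cubes t (shift_cubes s g)"
proof
  fix a
  show "shift_cubes s (shift_cubes t g) a = shift_cubes t (shift_cubes s g) a"
    unfolding shift_cubes_def by (subst sum.swap) (simp add: algebra_simps)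
qed

lemma sum_shift_cubes:
  fixes g :: "'a::{field,finite} \<Rightarrow> rat"
  shows "(\<Sum>a\<in>UNIV. shift_cubes s g a) = of_nat CARD('a) * (\<Sum>a\<in>UNIV. g a)"
  unfolding shift_cubes_def by (subst sum.swap) (simp add: sum_UNIV_translate)

text \<open>Replacing \<open>x\<close> by \<open>y * x\<close> permutes the summands. Thus the
  operator depends on \<open>s\<close> only up to nonzero cubes, and in \<open>z ^ i\<close> only
  \<open>i\<close> modulo 3 matters.\<close>

lemma shift_cubes_mult_cube:
  assumes "y \<noteq> 0"
  shows "shift_cubes (s * y ^ 3) g = shift_cubes s g"
proof
  fix a
  show "shift_cubes (s * y ^ 3) g a = shift_cubes s g a"
    using sum_UNIV_scale[OF assms, of "\<lambda>x. g (a - s * x ^ 3)"]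
    by (simp add: shift_cubes_def power_mult_distrib mult.assoc)
qed

lemma shift_cubes_twice:
  "shift_cubes s (shift_cubes s g) a = (\<Sum>b\<in>UNIV. of_nat (two_cubes b) * g (a - s * b))"
proof -
  have "shift_cubes s (shift_cubes s g) a = (\<Sum>x\<in>UNIV. \<Sum>y\<in>UNIV. g (a - s * (x ^ 3 + y ^ 3)))"
    by (simp add: shift_cubes_def algebra_simps)
  also have "\<dots> = (\<Sum>b\<in>UNIV. of_nat (two_cubes b) * g (a - s * b))"
    by (rule sum_over_two_cubes)
  finally show ?thesis .
qed

section \<open>Cosets of the cubes and the values of \<open>two_cubes\<close> on them\<close>

locale noncubic_element =
  fixes z :: "'a::{field,finite}" and f :: nat
  assumes card_eq: "CARD('a) = 3 * f + 1" and z_nonzero: "z \<noteq> 0" and z_noncubic: "\<not> cubic z"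
begin

abbreviation w :: 'a where "w \<equiv> z ^ f"

lemma f_pos: "f > 0"
  using CARD_field_gt_1[where 'a='a] card_eq by simp

lemma power_3f: "t \<noteq> 0 \<Longrightarrow> (t::'a) ^ (3 * f) = 1"
  using fermat_finite_field[of t] by (simp add: card_eq)

text \<open>Cubing is at most three-to-one on the \<open>3 * f\<close> nonzero elements, so there
  are at least \<open>f\<close> nonzero cubes. All of them satisfy \<open>t ^ f = 1\<close>, which
  has at most \<open>f\<close> solutions.\<close>

lemma cubic_iff:
  fixes t :: 'a
  assumes "t \<noteq> 0"
  shows "cubic t \<longleftrightarrow> t ^ f = 1"
proof -
  define H where "H = (\<lambda>y::'a. y ^ 3) ` (UNIV - {0})"
  have sub: "H \<subseteq> {t. t ^ f = 1}"
    by (auto simp: H_def power_3f simp flip: power_mult)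
  have "UNIV - {0} \<subseteq> (\<Union>h\<in>H. {y::'a. y ^ 3 = h})"
    by (auto simp: H_def)
  hence "card (UNIV - {0::'a}) \<le> card (\<Union>h\<in>H. {y::'a. y ^ 3 = h})"
    by (intro card_mono) auto
  also have "\<dots> \<le> (\<Sum>h\<in>H. card {y::'a. y ^ 3 = h})"
    by (rule card_UN_le) simp
  also have "\<dots> \<le> (\<Sum>h\<in>H. 3)"
    by (intro sum_mono card_nth_roots_le) simp
  finally have "card H \<ge> f" by (simp add: card_eq card_Diff_singleton)
  moreover have "card {t::'a. t ^ f = 1} \<le> f" by (rule card_nth_roots_le[OF f_pos])
  ultimately have "H = {t. t ^ f = 1}"
    using sub by (intro card_seteq) auto
  thus ?thesis by (auto simp: H_def cubic_def image_iff)
qed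

lemma w_cube: "w ^ 3 = 1"
  using power_3f[OF z_nonzero] by (simp add: mult.commute flip: power_mult)

lemma w_neq_1: "w \<noteq> 1"
  using cubic_iff[OF z_nonzero] z_noncubic by simp

lemma w_quadratic: "1 + w + w ^ 2 = 0"
proof -
  have "(w - 1) * (1 + w + w ^ 2) = w ^ 3 - 1"
    by (simp add: algebra_simps power2_eq_square power3_eq_cube)
  thus ?thesis using w_cube w_neq_1 by simp
qed

lemma w_nonzero: "w \<noteq> 0"
  using z_nonzero by simp

lemma w_square_neq: "w ^ 2 \<noteq> 1" "w ^ 2 \<noteq> w"
proof -
  show "w ^ 2 \<noteq> w" using w_neq_1 w_nonzero by (simp add: power2_eq_square)
  show "w ^ 2 \<noteq> 1"
  proof
    assume "w ^ 2 = 1"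
    hence "w ^ 3 = w" by (simp add: power3_eq_cube power2_eq_square)
    thus False using w_cube w_neq_1 by simp
  qed
qed

lemma cube_eq_1_cases:
  fixes u :: 'a
  assumes "u ^ 3 = 1"
  shows "u = 1 \<or> u = w \<or> u = w ^ 2"
proof -
  have e: "w ^ 2 = - 1 - w" using w_quadratic by (simp add: algebra_simps eq_neg_iff_add_eq_0)
  have "(u - 1) * ((u - w) * (u - w ^ 2)) = (u - 1) * (u ^ 2 - (w + w ^ 2) * u + w ^ 3)"
    by (simp add: algebra_simps power2_eq_square power3_eq_cube)
  also have "w + w ^ 2 = - 1" by (simp add: e)
  also have "(u - 1) * (u ^ 2 - (- 1) * u + w ^ 3) = u ^ 3 - 1"
    unfolding w_cube by (simp add: algebra_simps power2_eq_square power3_eq_cube)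
  finally have "(u - 1) * ((u - w) * (u - w ^ 2)) = u ^ 3 - 1" .
  thus ?thesis using assms by auto
qed

lemma cube_roots_cube:
  fixes y :: 'a
  assumes "y \<noteq> 0"
  shows "cube_roots (y ^ 3) = 3"
proof -
  have "cube_roots (y ^ 3) = cube_roots (1::'a)"
    using cube_roots_mult_cube[OF assms, of 1] by simp
  also have "{x::'a. x ^ 3 = 1} = {1, w, w ^ 2}"
  proof -
    have "(w ^ 2) ^ 3 = 1" using w_cube by (metis power_mult mult.commute power_one)
    thus ?thesis using cube_eq_1_cases w_cube by auto
  qed
  hence "cube_roots (1::'a) = 3"
    using w_neq_1 w_square_neq by (simp add: cube_roots_def)
  finally show ?thesis .
qed

lemma cube_roots_nonzero:
  fixes t :: 'a
  assumes "t \<noteq> 0"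
  shows "cube_roots t = (if t ^ f = 1 then 3 else 0)"
proof (cases "cubic t")
  case True
  then show ?thesis using cubic_iff[OF assms] cube_roots_cube by (auto simp: cubic_def)
next
  case False
  hence e: "{x. x ^ 3 = t} = {}" using assms by (auto simp: cubic_def)
  show ?thesis using False cubic_iff[OF assms] by (simp add: cube_roots_def e)
qed

text \<open>A nonzero \<open>b\<close> lies in exactly one of the three cosets of cubes, according
  to \<open>b ^ f\<close> being 1, \<open>w\<close> or \<open>w ^ 2\<close>, and is hit three times
  there; zero is hit once by each map.\<close>

lemma sum_coset_card:
  fixes b :: 'a
  shows "card {x. x ^ 3 = b} + card {x. z * x ^ 3 = b} + card {x. z ^ 2 * x ^ 3 = b} = 3"
proof (cases "b = 0")
  case True
  have "{x::'a. x ^ 3 = 0} = {0}" "{x. z * x ^ 3 = 0} = {0}" "{x. z ^ 2 * x ^ 3 = 0} = {0}"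
    using z_nonzero by auto
  with True show ?thesis by simp
next
  case False
  have "{x. z * x ^ 3 = b} = {x. x ^ 3 = b / z}" "{x. z ^ 2 * x ^ 3 = b} = {x. x ^ 3 = b / z ^ 2}"
    using z_nonzero by (auto simp: field_simps)
  hence "card {x. x ^ 3 = b} + card {x. z * x ^ 3 = b} + card {x. z ^ 2 * x ^ 3 = b}
       = cube_roots b + cube_roots (b / z) + cube_roots (b / z ^ 2)"
    by (simp add: cube_roots_def)
  also have "\<dots> = (if b ^ f = 1 then 3 else 0) + (if b ^ f = w then 3 else 0)
                + (if b ^ f = w ^ 2 then 3 else 0)"
    using False z_nonzero
    by (simp add: cube_roots_nonzero power_divide power_mult[symmetric] mult.commute)
  also have "\<dots> = 3"
  proof -
    have "(b ^ f) ^ 3 = 1" using power_3f[OF False] by (simp add: mult.commute flip: power_mult)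
    from cube_eq_1_cases[OF this] show ?thesis using w_neq_1 w_square_neq by auto
  qed
  finally show ?thesis .
qed

lemma sum_cosets:
  fixes g :: "'a \<Rightarrow> rat"
  shows "(\<Sum>x\<in>UNIV. g (x ^ 3)) + (\<Sum>x\<in>UNIV. g (z * x ^ 3)) + (\<Sum>x\<in>UNIV. g (z ^ 2 * x ^ 3))
    = 3 * (\<Sum>b\<in>UNIV. g b)"
proof -
  have "(\<Sum>x\<in>UNIV. g (x ^ 3)) + (\<Sum>x\<in>UNIV. g (z * x ^ 3)) + (\<Sum>x\<in>UNIV. g (z ^ 2 * x ^ 3))
     = (\<Sum>b\<in>UNIV. of_nat (card {x. x ^ 3 = b} + card {x. z * x ^ 3 = b} + card {x. z ^ 2 * x ^ 3 = b}) * g b)"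
    by (simp add: sum_fibre_card[of g] sum.distrib distrib_right)
  thus ?thesis by (simp add: sum_coset_card sum_distrib_left)
qed

text \<open>Each of the \<open>3 * f\<close> nonzero \<open>x\<close> has three partners
  \<open>y\<close> with \<open>y ^ 3 = - x ^ 3\<close>, and 0 has one.\<close>

lemma two_cubes_0: "two_cubes (0::'a) = 9 * f + 1"
proof -
  have "two_cubes (0::'a) = (\<Sum>t\<in>(UNIV::'a set). of_nat (cube_roots t) * cube_roots t)"
    by (simp add: two_cubes_def cube_roots_uminus)
  also have "\<dots> = (\<Sum>x\<in>(UNIV::'a set). cube_roots (x ^ 3))"
    by (rule sum_over_cubes[symmetric])
  also have "\<dots> = 1 + (\<Sum>x\<in>UNIV - {0::'a}. cube_roots (x ^ 3))"
    by (subst sum.remove[of _ 0]) auto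
  also have "(\<Sum>x\<in>UNIV - {0::'a}. cube_roots (x ^ 3)) = (\<Sum>x\<in>UNIV - {0::'a}. 3)"
    by (intro sum.cong) (auto simp: cube_roots_cube)
  finally show ?thesis by (simp add: card_Diff_singleton card_eq)
qed

text \<open>\<open>two_cubes\<close> is constant along \<open>s * x ^ 3\<close> for nonzero
  \<open>x\<close>, so only the term \<open>x = 0\<close> needs a correction.\<close>

lemma sum_two_cubes_coset:
  fixes g :: "'a \<Rightarrow> rat"
  shows "(\<Sum>x\<in>UNIV. of_nat (two_cubes (s * x ^ 3)) * g (s * x ^ 3))
    = of_nat (two_cubes s) * ((\<Sum>x\<in>UNIV. g (s * x ^ 3)) - g 0) + of_nat (9 * f + 1) * g 0"
proof -
  have "(\<Sum>x\<in>UNIV. of_nat (two_cubes (s * x ^ 3)) * g (s * x ^ 3))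
     = of_nat (9 * f + 1) * g 0 + (\<Sum>x\<in>UNIV-{0}. of_nat (two_cubes (s * x ^ 3)) * g (s * x ^ 3))"
    by (subst sum.remove[of _ 0]) (auto simp: two_cubes_0)
  also have "(\<Sum>x\<in>UNIV-{0}. of_nat (two_cubes (s * x ^ 3)) * g (s * x ^ 3))
     = (\<Sum>x\<in>UNIV-{0}. of_nat (two_cubes s) * g (s * x ^ 3))"
    by (intro sum.cong refl) (simp add: two_cubes_mult_cube mult.commute[of s])
  also have "\<dots> = of_nat (two_cubes s) * (\<Sum>x\<in>UNIV-{0}. g (s * x ^ 3))"
    by (simp add: sum_distrib_left)
  also have "(\<Sum>x\<in>UNIV-{0}. g (s * x ^ 3)) = (\<Sum>x\<in>UNIV. g (s * x ^ 3)) - g 0"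
    by (subst (2) sum.remove[of _ 0]) auto
  finally show ?thesis by simp
qed

text \<open>\<open>3 f - 1 = q - 2\<close> is the mean value of \<^const>\<open>two_cubes\<close> over the nonzero elements.\<close>

definition dev :: "nat \<Rightarrow> int" where
  "dev i = int (two_cubes (z ^ i)) - (3 * int f - 1)"

text \<open>Of the q^2 pairs, \<open>9 * f + 1\<close> lie over 0. The others lie over three cosets
  of \<open>f\<close> elements each, which makes the three values of \<open>two_cubes\<close> add up
  to \<open>9 * f - 3\<close>.\<close>

lemma dev_sum: "dev 0 + dev 1 + dev 2 = 0"
proof -
  have "(\<Sum>b\<in>(UNIV::'a set). of_nat (two_cubes b) :: rat) = of_nat (CARD('a)\<^sup>2)"
    by (simp flip: sum_two_cubes)
  hence "(\<Sum>x\<in>(UNIV::'a set). of_nat (two_cubes (x ^ 3)) :: rat) + (\<Sum>x\<in>UNIV. of_nat (two_cubes (z * x ^ 3)))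
     + (\<Sum>x\<in>UNIV. of_nat (two_cubes (z ^ 2 * x ^ 3))) = 3 * of_nat ((3 * f + 1)\<^sup>2)"
    using sum_cosets[of "\<lambda>b. of_nat (two_cubes b)"] by (simp add: card_eq)
  moreover have "(\<Sum>x\<in>UNIV. of_nat (two_cubes (s * x ^ 3)) :: rat)
    = of_nat (two_cubes s) * (3 * of_nat f) + of_nat (9 * f + 1)" for s :: 'a
    using sum_two_cubes_coset[of s "\<lambda>_. 1"] by (simp add: card_eq)
  note this[of 1] this[of z] this[of "z ^ 2"]
  ultimately have "rat_of_nat f * (of_nat (two_cubes (1::'a)) + of_nat (two_cubes z) + of_nat (two_cubes (z ^ 2)))
     = rat_of_nat f * (9 * of_nat f - 3)"
    by (simp add: algebra_simps power2_eq_square)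
  hence "rat_of_nat (two_cubes (1::'a)) + of_nat (two_cubes z) + of_nat (two_cubes (z ^ 2)) = 9 * of_nat f - 3"
    using f_pos by simp
  hence "rat_of_int (dev 0 + dev 1 + dev 2) = 0" by (simp add: dev_def)
  thus ?thesis by (simp only: of_int_eq_0_iff)
qed

lemma shift_cubes_sum:
  assumes "(\<Sum>a\<in>UNIV. g a) = 0" and s: "s \<noteq> 0"
  shows "shift_cubes s g a + shift_cubes (s * z) g a + shift_cubes (s * z ^ 2) g a = 0"
proof -
  have "(\<Sum>b\<in>UNIV. g (a - s * b)) = (\<Sum>b\<in>UNIV. g (a - b))"
    using sum_UNIV_scale[OF s, of "\<lambda>b. g (a - b)"] .
  also have "\<dots> = 0" using assms(1) by (simp add: sum_UNIV_reflect)
  finally show ?thesis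
    using sum_cosets[of "\<lambda>b. g (a - s * b)"] by (simp add: shift_cubes_def mult.assoc)
qed

text \<open>The square of the operator weights \<open>g (a - s * b)\<close> by
  \<open>two_cubes b\<close>; split the sum over \<open>b\<close> into cosets. The mean
  \<open>3 * f - 1\<close> drops out because the three shifted sums cancel, and collecting the
  values at \<open>b = 0\<close> leaves \<open>2 q g(a)\<close>.\<close>

lemma shift_cubes_square:
  assumes g: "(\<Sum>a\<in>UNIV. g a) = 0" and s: "s \<noteq> 0"
  shows "shift_cubes s (shift_cubes s g) a = 2 * of_nat CARD('a) * g a
    + (of_int (dev 0) * shift_cubes s g a + of_int (dev 1) * shift_cubes (s * z) g a
       + of_int (dev 2) * shift_cubes (s * z ^ 2) g a) / 3"
proof -
  let ?h = "\<lambda>b. g (a - s * b)"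
  have "3 * shift_cubes s (shift_cubes s g) a = 3 * (\<Sum>b\<in>UNIV. of_nat (two_cubes b) * ?h b)"
    by (simp add: shift_cubes_twice)
  also have "\<dots> = (\<Sum>x\<in>UNIV. of_nat (two_cubes (x ^ 3)) * ?h (x ^ 3))
     + (\<Sum>x\<in>UNIV. of_nat (two_cubes (z * x ^ 3)) * ?h (z * x ^ 3))
     + (\<Sum>x\<in>UNIV. of_nat (two_cubes (z ^ 2 * x ^ 3)) * ?h (z ^ 2 * x ^ 3))"
    by (rule sum_cosets[symmetric])
  also have "\<dots> = of_nat (two_cubes (1::'a)) * (shift_cubes s g a - g a)
     + of_nat (two_cubes z) * (shift_cubes (s * z) g a - g a)
     + of_nat (two_cubes (z ^ 2)) * (shift_cubes (s * z ^ 2) g a - g a)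
     + 3 * of_nat (9 * f + 1) * g a"
    using sum_two_cubes_coset[of 1 ?h] sum_two_cubes_coset[of z ?h] sum_two_cubes_coset[of "z ^ 2" ?h]
    by (simp add: shift_cubes_def mult.assoc)
  finally have "3 * shift_cubes s (shift_cubes s g) a = \<dots>" .
  moreover have t: "of_nat (two_cubes (1::'a)) = (of_int (dev 0) + 3 * of_nat f - 1 :: rat)"
    "of_nat (two_cubes z) = (of_int (dev 1) + 3 * of_nat f - 1 :: rat)"
    "of_nat (two_cubes (z ^ 2)) = (of_int (dev 2) + 3 * of_nat f - 1 :: rat)"
    by (simp_all add: dev_def)
  moreover have d: "of_int (dev 2) = (- of_int (dev 0) - of_int (dev 1) :: rat)"
    using dev_sum by (metis add_diff_cancel_left' diff_minus_eq_add of_int_diff of_int_minus uminus_add_conv_diff add.commute diff_0 minus_diff_eq add_diff_cancel_right')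
  moreover have sm: "shift_cubes (s * z ^ 2) g a = - shift_cubes s g a - shift_cubes (s * z) g a"
    using shift_cubes_sum[OF g s, of a] by linarith
  ultimately show ?thesis
    unfolding t d sm card_eq by (simp add: field_simps)
qed

end

section \<open>The algebra of the three operators on functions of sum zero\<close>

lemma shift_cubes_lin2:
  "shift_cubes s (\<lambda>a. - g a - h a) a = - shift_cubes s g a - shift_cubes s h a"
  by (simp add: shift_cubes_def sum_subtractf sum_negf)

text \<open>Like the preceding lemma this is linearity, in the exact shape of the right-hand sides
  of \<open>T_square\<close> and \<open>T_prod\<close>, so that a further operator can be applied to
  them.\<close>

lemma shift_cubes_lin4:
  "shift_cubes s (\<lambda>a. k * g a + (k0 * g0 a + k1 * g1 a + k2 * g2 a) / 3) a
    = k * shift_cubes s g a + (k0 * shift_cubes s g0 a + k1 * shift_cubes s g1 a + k2 * shift_cubes s g2 a) / 3"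
  by (simp add: shift_cubes_def sum.distrib sum_distrib_left flip: sum_divide_distrib)

context noncubic_element
begin

definition Q :: rat where "Q = of_nat (3 * f + 1)"
abbreviation u :: "nat \<Rightarrow> rat" where "u i \<equiv> of_int (dev i)"
abbreviation T :: "nat \<Rightarrow> ('a \<Rightarrow> rat) \<Rightarrow> 'a \<Rightarrow> rat" where "T i \<equiv> shift_cubes (z ^ i)"

lemma of_nat_CARD: "of_nat CARD('a) = Q"
  by (simp add: Q_def card_eq)

lemma u_2: "u 2 = - u 0 - u 1"
proof -
  have "dev 2 = - dev 0 - dev 1" using dev_sum by simp
  thus ?thesis by (simp only: of_int_diff of_int_minus)
qed

lemma T_2: "(\<Sum>a\<in>UNIV. g a) = 0 \<Longrightarrow> T 2 g = (\<lambda>a. - T 0 g a - T 1 g a)"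
  using shift_cubes_sum[of g 1] by (force simp: algebra_simps add_eq_0_iff)

lemma T_3: "T 3 = T 0" and T_4: "T 4 = T 1"
proof -
  show "T 3 = T 0" using shift_cubes_mult_cube[OF z_nonzero, of 1] by (simp add: fun_eq_iff)
  have "z ^ 4 = z * z ^ 3" by (simp add: numeral_eq_Suc)
  thus "T 4 = T 1" using shift_cubes_mult_cube[OF z_nonzero, of z] by (simp add: fun_eq_iff)
qed

lemma T_square:
  assumes "(\<Sum>a\<in>UNIV. g a) = 0"
  shows "T 0 (T 0 g) a = 2 * Q * g a + (u 0 * T 0 g a + u 1 * T 1 g a + u 2 * T 2 g a) / 3"
    and "T 1 (T 1 g) a = 2 * Q * g a + (u 0 * T 1 g a + u 1 * T 2 g a + u 2 * T 0 g a) / 3"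
    and "T 2 (T 2 g) a = 2 * Q * g a + (u 0 * T 2 g a + u 1 * T 0 g a + u 2 * T 1 g a) / 3"
proof -
  have p: "z * z = z ^ 2" "z * z ^ 2 = z ^ 3" "z ^ 2 * z = z ^ 3" "z ^ 2 * z ^ 2 = z ^ 4"
    by (simp_all add: numeral_eq_Suc)
  show "T 0 (T 0 g) a = 2 * Q * g a + (u 0 * T 0 g a + u 1 * T 1 g a + u 2 * T 2 g a) / 3"
    using shift_cubes_square[OF assms, of 1] by (simp add: of_nat_CARD)
  show "T 1 (T 1 g) a = 2 * Q * g a + (u 0 * T 1 g a + u 1 * T 2 g a + u 2 * T 0 g a) / 3"
    using shift_cubes_square[OF assms z_nonzero] T_3 by (simp add: p of_nat_CARD)
  show "T 2 (T 2 g) a = 2 * Q * g a + (u 0 * T 2 g a + u 1 * T 0 g a + u 2 * T 1 g a) / 3"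
    using shift_cubes_square[OF assms, of "z ^ 2"] z_nonzero T_3 T_4 by (simp add: p of_nat_CARD)
qed

lemma sum_T: "(\<Sum>a\<in>UNIV. g a) = 0 \<Longrightarrow> (\<Sum>a\<in>UNIV. T i g a) = 0"
  by (simp add: sum_shift_cubes)

text \<open>Squaring \<open>T 2 = - T 0 - T 1\<close> expresses \<open>T 0 T 1\<close> as half of
  \<open>T 2 T 2 - T 0 T 0 - T 1 T 1\<close>. The other two products follow by substituting for
  \<open>T 2\<close> again.\<close>

lemma T_prod:
  assumes g: "(\<Sum>a\<in>UNIV. g a) = 0"
  shows "T 0 (T 1 g) a = - Q * g a + (u 0 * T 2 g a + u 1 * T 0 g a + u 2 * T 1 g a) / 3"
    and "T 0 (T 2 g) a = - Q * g a + (u 0 * T 1 g a + u 1 * T 2 g a + u 2 * T 0 g a) / 3"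
    and "T 1 (T 2 g) a = - Q * g a + (u 0 * T 0 g a + u 1 * T 1 g a + u 2 * T 2 g a) / 3"
proof -
  have T2: "T 2 g a = - T 0 g a - T 1 g a" by (simp only: T_2[OF g])
  have T02: "T 0 (T 2 g) a = - T 0 (T 0 g) a - T 0 (T 1 g) a"
    and T12: "T 1 (T 2 g) a = - T 0 (T 1 g) a - T 1 (T 1 g) a"
    by (simp_all only: T_2[OF g] shift_cubes_lin2 shift_cubes_commute[of "z ^ 1" "z ^ 0"])
  have "T 2 (T 2 g) a = - T 0 (T 2 g) a - T 1 (T 2 g) a"
    using fun_cong[OF T_2[OF sum_T[OF g, of 2]], of a] .
  hence "T 0 (T 1 g) a = (T 2 (T 2 g) a - T 0 (T 0 g) a - T 1 (T 1 g) a) / 2"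
    using T02 T12 by (simp add: field_simps)
  thus T01: "T 0 (T 1 g) a = - Q * g a + (u 0 * T 2 g a + u 1 * T 0 g a + u 2 * T 1 g a) / 3"
    unfolding T_square[OF g] T2 by (simp add: field_simps)
  show "T 0 (T 2 g) a = - Q * g a + (u 0 * T 1 g a + u 1 * T 2 g a + u 2 * T 0 g a) / 3"
    unfolding T02 T01 T_square[OF g] T2 by (simp add: field_simps)
  show "T 1 (T 2 g) a = - Q * g a + (u 0 * T 0 g a + u 1 * T 1 g a + u 2 * T 2 g a) / 3"
    unfolding T12 T01 T_square[OF g] T2 by (simp add: field_simps)
qed

text \<open>Subtracting the mean \<open>1 / Q\<close> gives the sum zero that the operator relations
  require.\<close>

definition centred_delta :: "'a \<Rightarrow> rat" where
  "centred_delta a = of_bool (a = 0) - 1 / Q"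

lemma Q_pos: "Q > 0"
  by (simp add: Q_def add_pos_nonneg)

lemma sum_centred_delta: "(\<Sum>a\<in>UNIV. centred_delta a) = 0"
proof -
  have "(\<Sum>a\<in>UNIV. of_bool (a = (0::'a)) :: rat) = 1"
    by (subst sum.remove[of _ 0]) auto
  thus ?thesis using Q_pos by (simp add: centred_delta_def sum_subtractf of_nat_CARD)
qed

lemma T_centred_delta: "T i centred_delta a = of_nat (card {x. z ^ i * x ^ 3 = a}) - 1"
proof -
  have "T i centred_delta a = (\<Sum>x\<in>UNIV. of_bool (z ^ i * x ^ 3 = a)) - 1"
    using Q_pos by (simp add: shift_cubes_def centred_delta_def sum_subtractf eq_commute[of a] of_nat_CARD)
  also have "(\<Sum>x\<in>UNIV. of_bool (z ^ i * x ^ 3 = a) :: rat) = of_nat (card {x. z ^ i * x ^ 3 = a})"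
    by (simp add: of_bool_def sum.If_cases)
  finally show ?thesis .
qed

text \<open>Comparing \<open>(T 0 T 0) T 1\<close> with \<open>T 0 (T 0 T 1)\<close> plays the role of the absolute value
  \<open>\<surd>q\<close> of a Jacobi sum.\<close>

lemma dev_e2: "dev 0 * dev 1 + dev 1 * dev 2 + dev 2 * dev 0 = - 3 * int CARD('a)"
proof -
  let ?g = centred_delta
  note g = sum_centred_delta
  let ?e = "u 0 * u 1 + u 1 * u 2 + u 2 * u 0"
  have "T 0 (T 0 (T 1 ?g)) z = 2 * Q * T 1 ?g z
      + (u 0 * T 0 (T 1 ?g) z + u 1 * T 1 (T 1 ?g) z + u 2 * T 1 (T 2 ?g) z) / 3"
    using T_square(1)[OF sum_T[OF g, of 1], of z]
    by (simp only: shift_cubes_commute[of "z ^ 2" "z ^ 1"])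
  moreover have "T 0 (T 0 (T 1 ?g)) z = - Q * T 0 ?g z
      + (u 0 * T 0 (T 2 ?g) z + u 1 * T 0 (T 0 ?g) z + u 2 * T 0 (T 1 ?g) z) / 3"
    by (subst ext[OF T_prod(1)[OF g]]) (rule shift_cubes_lin4)
  ultimately have "2 * Q * T 1 ?g z
      + (u 0 * T 0 (T 1 ?g) z + u 1 * T 1 (T 1 ?g) z + u 2 * T 1 (T 2 ?g) z) / 3
    = - Q * T 0 ?g z
      + (u 0 * T 0 (T 2 ?g) z + u 1 * T 0 (T 0 ?g) z + u 2 * T 0 (T 1 ?g) z) / 3"
    by (rule trans[OF sym])
  \<comment> \<open>Everything is reduced to \<open>?g z\<close>, \<open>T 0 ?g z\<close> and
    \<open>T 1 ?g z\<close> before comparing.\<close>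
  hence "(Q + ?e / 3) * (T 1 ?g z - T 2 ?g z) = 0"
    unfolding T_prod[OF g] T_square[OF g] u_2 fun_cong[OF T_2[OF g], of z]
    by (simp add: field_simps)
  \<comment> \<open>This is why the point \<open>z\<close> was chosen: \<open>z = z * 1 ^ 3\<close>,
    whereas \<open>z = z ^ 2 * x ^ 3\<close> would make \<open>z\<close> the cube of
    \<open>1 / x\<close>.\<close>
  moreover have "T 1 ?g z \<noteq> T 2 ?g z"
  proof -
    have "1 \<in> {x. z * x ^ 3 = z}" by simp
    hence "card {x. z * x ^ 3 = z} \<noteq> 0" by (metis card_0_eq empty_iff finite)
    moreover have "{x. z ^ 2 * x ^ 3 = z} = {}"
    proof -
      have "z ^ 2 * x ^ 3 \<noteq> z" for x
      proof
        assume "z ^ 2 * x ^ 3 = z"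
        hence "z * x ^ 3 = 1" using z_nonzero by (simp add: power2_eq_square)
        moreover from this have "x \<noteq> 0" by auto
        ultimately have "z = (1 / x) ^ 3" "1 / x \<noteq> 0" by (auto simp: field_simps power_divide)
        thus False using z_noncubic unfolding cubic_def by blast
      qed
      thus ?thesis by simp
    qed
    moreover have "rat_of_nat n - 1 \<noteq> of_nat 0 - 1" if "n \<noteq> 0" for n using that by simp
    ultimately show ?thesis 
      using T_centred_delta[of 1 z] T_centred_delta[of 2 z] by (simp only: power_one_right card.empty not_False_eq_True)
  qed
  ultimately have "Q + ?e / 3 = 0" by simp
  moreover have "e = - 3 * Q" if "Q + e / 3 = 0" for e using that by linarith
  ultimately have "?e = - 3 * Q" by blast
  hence "rat_of_int (dev 0 * dev 1 + dev 1 * dev 2 + dev 2 * dev 0) = rat_of_int (- 3 * int CARD('a))"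
    by (simp add: of_nat_CARD)
  thus ?thesis by (simp only: of_int_eq_iff)
qed

text \<open>Let e be the sum in \<open>dev_e2\<close>, so e = -3q. When \<open>T 0\<close> is
  applied to its own square and the products are reduced, \<open>T 1\<close> and \<open>T 2\<close>
  both get the coefficient e/9, so together they give -e/9 times \<open>T 0\<close>.\<close>

lemma T_cubic:
  assumes g: "(\<Sum>a\<in>UNIV. g a) = 0"
  shows "T 0 (T 0 (T 0 g)) a = 3 * Q * T 0 g a + Q * u 0 * g a"
proof -
  have "rat_of_int (dev 0 * dev 1 + dev 1 * dev 2 + dev 2 * dev 0) = - 3 * Q"
    by (simp only: dev_e2) (simp add: of_nat_CARD)
  hence Q: "Q = (u 0 * u 0 + u 0 * u 1 + u 1 * u 1) / 3" by (simp add: u_2 algebra_simps)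
  have "T 0 (T 0 (T 0 g)) a = 2 * Q * T 0 g a
      + (u 0 * T 0 (T 0 g) a + u 1 * T 0 (T 1 g) a + u 2 * T 0 (T 2 g) a) / 3"
    by (subst ext[OF T_square(1)[OF g]]) (rule shift_cubes_lin4)
  also have "\<dots> = 3 * Q * T 0 g a + Q * u 0 * g a"
    unfolding T_prod[OF g] T_square[OF g] u_2 fun_cong[OF T_2[OF g], of a]
    by (simp add: Q field_simps)
  finally show ?thesis .
qed

section \<open>The recurrence for the deviation of \<open>B n z\<close> from q^n\<close>

lemma sum_T_iterate: "(\<Sum>a\<in>UNIV. (T 0 ^^ n) centred_delta a) = 0"
  by (induction n) (auto simp: sum_centred_delta sum_shift_cubes)

text \<open>By \<open>B_eq_excess\<close> below, this is \<open>B n z\<close> minus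
  \<open>Q ^ n\<close>.\<close>

definition excess :: "nat \<Rightarrow> rat" where
  "excess n = T 1 ((T 0 ^^ n) centred_delta) 0"

lemma excess_rec: "excess (n + 3) = 3 * Q * excess (n + 1) + Q * u 0 * excess n"
proof -
  let ?g = "(T 0 ^^ n) centred_delta"
  have "(T 0 ^^ (n + 3)) centred_delta = (\<lambda>a. 3 * Q * T 0 ?g a + Q * u 0 * ?g a)"
    using T_cubic[OF sum_T_iterate[of n]] by (simp add: numeral_3_eq_3 fun_eq_iff)
  thus ?thesis by (simp add: excess_def shift_cubes_add shift_cubes_cmult)
qed

text \<open>Since \<open>z ^ i * x ^ 3 = 0\<close> has exactly one solution, every
  \<open>T i centred_delta\<close> vanishes at 0. Only the multiples of
  \<open>centred_delta 0\<close> in the product relations survive.\<close>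

lemma excess_init: "excess 0 = 0" "excess 1 = - (Q - 1)" "excess 2 = (Q - 1) * u 1"
proof -
  note g = sum_centred_delta
  have "{x. z ^ i * x ^ 3 = 0} = {0}" for i using z_nonzero by auto
  hence T0: "T i centred_delta 0 = 0" for i by (simp add: T_centred_delta)
  from this[of 1] show "excess 0 = 0" by (simp add: excess_def)
  have d0: "Q * centred_delta 0 = Q - 1" using Q_pos by (simp add: centred_delta_def field_simps)
  have "excess 1 = T 0 (T 1 centred_delta) 0"
    by (simp add: excess_def shift_cubes_commute[of z 1])
  also have "\<dots> = - (Q * centred_delta 0)" unfolding T_prod[OF g] T0 by simp
  finally show "excess 1 = - (Q - 1)" using d0 by simp
  have "excess 2 = T 1 (T 0 (T 0 centred_delta)) 0"
    by (simp add: excess_def numeral_2_eq_2)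
  also have "\<dots> = 2 * Q * T 1 centred_delta 0
      + (u 0 * T 0 (T 1 centred_delta) 0 + u 1 * T 1 (T 1 centred_delta) 0 + u 2 * T 1 (T 2 centred_delta) 0) / 3"
    unfolding shift_cubes_commute[of "z ^ 0" "z ^ 1"] shift_cubes_commute[of "z ^ 2" "z ^ 1"]
    by (subst ext[OF T_square(1)[OF g]]) (rule shift_cubes_lin4)
  also have "\<dots> = (Q * centred_delta 0) * u 1"
    unfolding T_prod[OF g] T_square[OF g] T0 u_2 by (simp add: field_simps)
  finally show "excess 2 = (Q - 1) * u 1" using d0 by simp
qed

end

section \<open>Solution counts as iterates of the operators\<close>

lemma card_extend_solution:
  fixes h k :: "'a::finite \<Rightarrow> 'b::ab_group_add"
  shows "card {x \<in> {1..Suc n} \<rightarrow>\<^sub>E (UNIV :: 'a set). (\<Sum>i=1..n. h (x i)) + k (x (Suc n)) = b}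
     = (\<Sum>y\<in>UNIV. card {x \<in> {1..n} \<rightarrow>\<^sub>E (UNIV :: 'a set). (\<Sum>i=1..n. h (x i)) = b - k y})"
    (is "card ?A = (\<Sum>y\<in>UNIV. card (?C y))")
proof -
  have "bij_betw (\<lambda>(y, x). x(Suc n := y)) (Sigma UNIV ?C) ?A"
  \<comment> \<open>Dropping the last coordinate means resetting it to \<open>undefined\<close>, the
    value of extensional functions outside their domain.\<close>
  proof (rule bij_betw_byWitness[where f' = "\<lambda>x. (x (Suc n), x(Suc n := undefined))"])
    have cong: "(\<Sum>i=1..n. h ((x(Suc n := y)) i)) = (\<Sum>i=1..n. h (x i))" for x y
      by (intro sum.cong) auto
    show "(\<lambda>(y, x). x(Suc n := y)) ` Sigma UNIV ?C \<subseteq> ?A"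
      by (auto simp: cong simp del: fun_upd_apply intro!: PiE_I) (auto simp: PiE_def extensional_def)
    show "(\<lambda>x. (x (Suc n), x(Suc n := undefined))) ` ?A \<subseteq> Sigma UNIV ?C"
      by (auto simp: cong simp del: fun_upd_apply) (auto simp: PiE_def extensional_def algebra_simps)
    show "\<forall>a\<in>Sigma UNIV ?C. (\<lambda>x. (x (Suc n), x(Suc n := undefined))) ((\<lambda>(y, x). x(Suc n := y)) a) = a"
      by (auto simp: PiE_def extensional_def fun_eq_iff)
    show "\<forall>a\<in>?A. (\<lambda>(y, x). x(Suc n := y)) ((\<lambda>x. (x (Suc n), x(Suc n := undefined))) a) = a"
      by (auto simp: fun_eq_iff)
  qed
  hence "card ?A = card (Sigma UNIV ?C)" by (simp add: bij_betw_same_card)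
  also have "\<dots> = (\<Sum>y\<in>UNIV. card (?C y))"
  proof (intro card_SigmaI ballI)
    show "finite (?C y)" for y
      by (rule finite_subset[OF _ finite_PiE[of "{1..n}" "\<lambda>_. UNIV"]]) auto
  qed simp
  finally show ?thesis .
qed

context noncubic_element
begin

text \<open>Each application of \<open>T 0\<close> adds one cube and multiplies the subtracted
  constant by \<open>Q\<close>. That constant is written \<open>Q ^ n / Q\<close> to cover
  \<open>n = 0\<close>.\<close>

lemma T_iterate_eq_card:
  "(T 0 ^^ n) centred_delta a
    = of_nat (card {x \<in> {1..n} \<rightarrow>\<^sub>E (UNIV :: 'a set). (\<Sum>i=1..n. x i ^ 3) = a}) - Q ^ n / Q"
proof (induction n arbitrary: a)
  case 0
  have "{x. x = (\<lambda>_. undefined) \<and> a = 0} = (if a = 0 then {\<lambda>_::nat. undefined::'a} else {})" by auto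
  then show ?case by (auto simp: centred_delta_def eq_commute[of 0 a])
next
  case (Suc n)
  have "(T 0 ^^ Suc n) centred_delta a = (\<Sum>y\<in>UNIV. (T 0 ^^ n) centred_delta (a - y ^ 3))"
    by (simp add: shift_cubes_def)
  also have "\<dots> = of_nat (\<Sum>y\<in>UNIV. card {x \<in> {1..n} \<rightarrow>\<^sub>E (UNIV :: 'a set). (\<Sum>i=1..n. x i ^ 3) = a - y ^ 3}) - Q * (Q ^ n / Q)"
    by (simp only: Suc.IH sum_subtractf of_nat_sum sum_constant of_nat_CARD)
  also have "(\<Sum>y\<in>UNIV. card {x \<in> {1..n} \<rightarrow>\<^sub>E (UNIV :: 'a set). (\<Sum>i=1..n. x i ^ 3) = a - y ^ 3})
    = card {x \<in> {1..Suc n} \<rightarrow>\<^sub>E (UNIV :: 'a set). (\<Sum>i=1..Suc n. x i ^ 3) = a}"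
    using card_extend_solution[of n "\<lambda>x::'a. x ^ 3" "\<lambda>x. x ^ 3" a] by simp
  finally show ?case by simp
qed

lemma B_eq_excess: "of_nat (B n z) = Q ^ n + excess n"
proof -
  have "excess n = of_nat (\<Sum>y\<in>UNIV. card {x \<in> {1..n} \<rightarrow>\<^sub>E (UNIV :: 'a set). (\<Sum>i=1..n. x i ^ 3) = 0 - z * y ^ 3}) - Q * (Q ^ n / Q)"
    unfolding excess_def by (subst shift_cubes_def) (simp only: T_iterate_eq_card sum_subtractf of_nat_sum sum_constant of_nat_CARD power_one_right)
  also have "\<dots> = of_nat (B n z) - Q ^ n"
    using Q_pos card_extend_solution[of n "\<lambda>x::'a. x ^ 3" "\<lambda>x. z * x ^ 3" 0] by (simp add: B_def)
  finally show ?thesis by simp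
qed

end

section \<open>The form \<open>c\<^sup>2 + 27 d\<^sup>2\<close>\<close>

lemma int_dvd_abs_lt_imp_0:
  fixes D q :: int
  assumes "q dvd D" "27 * D\<^sup>2 \<le> (4 * q)\<^sup>2" "q > 0"
  shows "D = 0"
proof (rule ccontr)
  assume "D \<noteq> 0"
  hence "q \<le> \<bar>D\<bar>" using assms(1) by (metis dvd_imp_le_int abs_of_pos assms(3))
  hence "q\<^sup>2 \<le> D\<^sup>2" using assms(3) by (metis abs_le_square_iff abs_of_pos)
  moreover have "q\<^sup>2 > 0" using assms(3) by simp
  moreover have "27 * D\<^sup>2 \<le> 16 * q\<^sup>2" using assms(2) by (simp add: power_mult_distrib)
  ultimately show False by linarith
qed

lemma eq_of_squares_eq_mod_3:
  fixes c c' :: int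
  assumes "c\<^sup>2 = c'\<^sup>2" "[c = 1] (mod 3)" "[c' = 1] (mod 3)"
  shows "c = c'"
proof -
  have "c = c' \<or> c = - c'" using assms(1) by (simp add: power2_eq_iff)
  moreover have "c \<noteq> - c'" using assms(2,3) unfolding cong_def by presburger
  ultimately show ?thesis by simp
qed

text \<open>The product of \<open>c * d' - c' * d\<close> and \<open>c * d' + c' * d\<close> is
  divisible by \<open>p ^ k\<close>. As p divides the first factor it cannot divide the second, for
  then it would divide \<open>d'\<close> and so \<open>c'\<close>. Hence \<open>p ^ k\<close>
  divides the first factor, which is too small to be nonzero.\<close>

lemma representation_unique_split:
  fixes p c d c' d' :: int
  assumes p: "prime p" "p \<noteq> 2"
    and c: "coprime c p" "c\<^sup>2 + 27 * d\<^sup>2 = 4 * p ^ k" "[c = 1] (mod 3)"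
    and c': "coprime c' p" "c'\<^sup>2 + 27 * d'\<^sup>2 = 4 * p ^ k" "[c' = 1] (mod 3)"
    and k: "k \<ge> 1" and cong: "p dvd c * d' - c' * d"
  shows "c = c' \<and> d = d'"
proof -
  have nd: "\<not> p dvd c" "\<not> p dvd c'"
    using c(1) c'(1) p(1) by (metis coprime_absorb_right not_prime_unit coprime_commute)+
  have "\<not> p dvd c * d' + c' * d"
  proof
    assume "p dvd c * d' + c' * d"
    with cong have "p dvd (c * d' - c' * d) + (c * d' + c' * d)" by (rule dvd_add)
    hence "p dvd 2 * (c * d')" by simp
    moreover have "\<not> p dvd 2" using p primes_dvd_imp_eq[of p 2] by auto
    ultimately have "p dvd d'" using p nd by (auto simp: prime_dvd_mult_iff)
    moreover have "p dvd 4 * p ^ k" using k by (simp add: dvd_power)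
    ultimately have "p dvd 4 * p ^ k - 27 * d'\<^sup>2" by (intro dvd_diff) (auto simp: power2_eq_square)
    also have "\<dots> = c'\<^sup>2" using c'(2) by simp
    finally show False using nd p prime_dvd_power by blast
  qed
  hence cop: "coprime (p ^ k) (c * d' + c' * d)"
    using p by (simp add: prime_imp_coprime)
  have "(c * d' - c' * d) * (c * d' + c' * d) = c\<^sup>2 * d'\<^sup>2 - c'\<^sup>2 * d\<^sup>2"
    by (simp add: algebra_simps power2_eq_square)
  also have "\<dots> = p ^ k * (4 * (d'\<^sup>2 - d\<^sup>2))"
  proof -
    have "c\<^sup>2 = 4 * p ^ k - 27 * d\<^sup>2" "c'\<^sup>2 = 4 * p ^ k - 27 * d'\<^sup>2" using c(2) c'(2) by simp_all
    thus ?thesis by (simp only:) (simp add: algebra_simps)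
  qed
  finally have "p ^ k dvd (c * d' - c' * d) * (c * d' + c' * d)" by simp
  hence "p ^ k dvd c * d' - c' * d"
    using cop by (simp add: coprime_dvd_mult_left_iff)
  \<comment> \<open>Multiplicativity of the form bounds the first factor.\<close>
  moreover have "(4 * p ^ k)\<^sup>2 = (c * c' + 27 * d * d')\<^sup>2 + 27 * (c * d' - c' * d)\<^sup>2"
  proof -
    have "(4 * p ^ k)\<^sup>2 = (c\<^sup>2 + 27 * d\<^sup>2) * (c'\<^sup>2 + 27 * d'\<^sup>2)"
      unfolding c(2) c'(2) by (rule power2_eq_square)
    thus ?thesis by (simp add: algebra_simps power2_eq_square)
  qed
  hence "27 * (c * d' - c' * d)\<^sup>2 \<le> (4 * p ^ k)\<^sup>2" by simp
  moreover have "p ^ k > 0" using p by (simp add: prime_gt_0_int)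
  ultimately have "c * d' - c' * d = 0" by (rule int_dvd_abs_lt_imp_0)
  hence e: "c * d' = c' * d" by simp
  have "c\<^sup>2 * (c'\<^sup>2 + 27 * d'\<^sup>2) = c\<^sup>2 * c'\<^sup>2 + 27 * (c * d')\<^sup>2" by (simp add: algebra_simps)
  also have "\<dots> = c'\<^sup>2 * (c\<^sup>2 + 27 * d\<^sup>2)" unfolding e by (simp add: algebra_simps)
  finally have "c\<^sup>2 = c'\<^sup>2" using c(2) c'(2) p by simp
  hence "c = c'" using c(3) c'(3) by (rule eq_of_squares_eq_mod_3)
  moreover have "c \<noteq> 0" using nd by auto
  ultimately show ?thesis using e by simp
qed

text \<open>For \<open>p = 3 * m + 2\<close> the exponent \<open>2 * m + 1\<close> inverts cubing:
  three times it is \<open>p + (p - 1)\<close>, and Fermat gives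
  \<open>x ^ p * x ^ (p - 1) = x\<close> modulo p.\<close>

lemma cube_inj_mod_prime:
  fixes p :: nat and a b :: int
  assumes p: "prime p" "p mod 3 = 2" and ab: "[a ^ 3 = b ^ 3] (mod int p)"
  shows "[a = b] (mod int p)"
proof -
  obtain m where m: "p = 3 * m + 2" using p(2) by (metis mult_div_mod_eq)
  have fermat: "[x ^ p = x] (mod int p)" for x :: int
  proof (cases "int p dvd x")
    case True
    then show ?thesis using p by (simp add: cong_def prime_gt_0_nat dvd_power mod_eq_0_iff_dvd dvd_trans[OF _ dvd_power])
  next
    case False
    have "[x ^ (p - 1) = 1] (mod int p)"
    proof -
      define y where "y = nat (x mod int p)"
      have y: "int y = x mod int p" using p by (simp add: y_def prime_gt_0_nat)
      hence "\<not> p dvd y" using False by (metis dvd_mod_iff dvd_refl int_dvd_int_iff)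
      hence "[y ^ (p - 1) = 1] (mod p)" using p by (intro fermat_theorem) auto
      hence "[int y ^ (p - 1) = 1] (mod int p)" by (metis cong_int_iff of_nat_1 of_nat_power)
      thus ?thesis unfolding y by (simp add: cong_def power_mod)
    qed
    hence "[x * x ^ (p - 1) = x * 1] (mod int p)" by (rule cong_scalar_left)
    then show ?thesis using p by (metis mult_1_right power_eq_if prime_gt_0_nat neq0_conv)
  qed
  have *: "[(x ^ 3) ^ (2 * m + 1) = x] (mod int p)" for x :: int
  proof -
    have "p + (p - 1) = 3 * (2 * m + 1)" using m by simp
    hence "(x ^ 3) ^ (2 * m + 1) = x ^ (p + (p - 1))" by (simp only: power_mult)
    also have "\<dots> = x ^ p * x ^ (p - 1)" by (rule power_add)
    also have "[\<dots> = x * x ^ (p - 1)] (mod int p)" using fermat by (rule cong_scalar_right)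
    also have "x * x ^ (p - 1) = x ^ p" using m by simp
    also have "[\<dots> = x] (mod int p)" by (rule fermat)
    finally show ?thesis .
  qed
  have "[(a ^ 3) ^ (2 * m + 1) = (b ^ 3) ^ (2 * m + 1)] (mod int p)"
    using ab by (rule cong_pow)
  thus ?thesis using *[of a] *[of b] by (meson cong_sym cong_trans)
qed

lemma inert_prime_dvd:
  fixes p :: nat and c d :: int
  assumes p: "prime p" "p mod 3 = 2" and k: "k \<ge> 2" and eq: "c\<^sup>2 + 27 * d\<^sup>2 = 4 * int p ^ k"
  shows "int p dvd c \<and> int p dvd d"
proof (cases "p = 2")
  case True
  obtain j where j: "k = j + 2" using k by (metis le_add_diff_inverse2)
  \<comment> \<open>For p = 2 work modulo 8: odd squares are 1, and 1 + 27 is not divisible by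
    8.\<close>
  have "8 dvd c\<^sup>2 + 27 * d\<^sup>2" unfolding eq True j by (simp add: power_add)
  have sq: "even x \<or> x\<^sup>2 mod 8 = 1" for x :: int
  proof (cases "even x")
    case False
    then obtain y where y: "x = 2 * y + 1" by (rule oddE)
    have "x\<^sup>2 = 4 * (y * (y + 1)) + 1" by (simp add: y power2_eq_square algebra_simps)
    moreover have "even (y * (y + 1))" by simp
    then obtain e where "y * (y + 1) = 2 * e" by (rule evenE)
    ultimately have "x\<^sup>2 = 8 * e + 1" by simp
    thus ?thesis by presburger
  qed simp
  have "even (c\<^sup>2 + 27 * d\<^sup>2)" using \<open>8 dvd _\<close> by (rule dvd_trans[rotated]) simp
  hence "even c \<longleftrightarrow> even d" by simp
  moreover have "\<not> (c\<^sup>2 mod 8 = 1 \<and> d\<^sup>2 mod 8 = 1)"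
  proof -
    have "\<not> 8 dvd x + 27 * y" if "x mod 8 = 1" "y mod 8 = 1" for x y :: int
      using that by presburger
    thus ?thesis using \<open>8 dvd _\<close> by blast
  qed
  ultimately show ?thesis using True sq[of c] sq[of d] by auto
next
  case False
  have pp: "prime (int p)" using p by simp
  have np: "\<not> int p dvd 2" "\<not> int p dvd 3"
  proof -
    show "\<not> int p dvd 2" using pp False primes_dvd_imp_eq[of "int p" 2] by auto
    show "\<not> int p dvd 3" using pp p(2) primes_dvd_imp_eq[of "int p" 3] by auto
  qed
  have pd: "int p dvd c\<^sup>2 + 27 * d\<^sup>2" using k unfolding eq by (simp add: dvd_power)
  define s where "s = 3 * d"
  \<comment> \<open>The form is a factor of a difference of two cubes, so injectivity of cubing
    yields \<open>c = 9 * d\<close> modulo p. The form is then \<open>108 * d\<^sup>2\<close> modulo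
    p, and 108 is prime to p.\<close>
  have "(c - s) ^ 3 - (2 * s) ^ 3 = (c - 3 * s) * (c\<^sup>2 + 27 * d\<^sup>2)"
    by (simp add: s_def algebra_simps power2_eq_square power3_eq_cube)
  hence "[(c - s) ^ 3 = (2 * s) ^ 3] (mod int p)"
    using pd by (simp add: cong_iff_dvd_diff)
  hence "[c - s = 2 * s] (mod int p)" by (rule cube_inj_mod_prime[OF p])
  hence cs: "int p dvd c - 9 * d" by (simp add: cong_iff_dvd_diff s_def algebra_simps)
  have "c\<^sup>2 + 27 * d\<^sup>2 = (c - 9 * d) * (c + 9 * d) + 2 * 2 * 3 * 3 * 3 * d\<^sup>2"
    by (simp add: algebra_simps power2_eq_square)
  with pd have "int p dvd (c - 9 * d) * (c + 9 * d) + 2 * 2 * 3 * 3 * 3 * d\<^sup>2" by (simp only:)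
  hence "int p dvd 2 * 2 * 3 * 3 * 3 * d\<^sup>2"
    using cs by (metis dvd_add_right_iff dvd_mult2)
  hence d: "int p dvd d" using np pp by (metis prime_dvd_mult_iff prime_dvd_power)
  hence "int p dvd (c - 9 * d) + 9 * d" using cs by (intro dvd_add) auto
  thus ?thesis using d by simp
qed

text \<open>Descent: for \<open>k \<ge> 2\<close> both \<open>c\<close> and \<open>d\<close> are
  divisible by p, which lowers \<open>k\<close> by 2. The exponent 1 is impossible since
  \<open>c\<^sup>2\<close> would be 2 modulo 3, and for exponent 0 a nonzero \<open>d\<close> is too
  large.\<close>

lemma representation_inert:
  fixes p :: nat and c d :: int
  assumes p: "prime p" "p mod 3 = 2" and eq: "c\<^sup>2 + 27 * d\<^sup>2 = 4 * int p ^ k"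
  shows "d = 0"
  using eq
proof (induction k arbitrary: c d rule: less_induct)
  case (less k)
  consider "k = 0" | "k = 1" | "k \<ge> 2" by linarith
  then show ?case
  proof cases
    case 1
    hence "c\<^sup>2 + 27 * d\<^sup>2 = 4" using less.prems by simp
    moreover have "d\<^sup>2 \<ge> 1" if "d \<noteq> 0" using that by (simp add: int_one_le_iff_zero_less)
    ultimately show ?thesis by (smt (verit) zero_le_power2)
  next
    case 2
    have "c\<^sup>2 mod 3 = 2"
    proof -
      obtain m where "p = 3 * m + 2" using p(2) by (metis mult_div_mod_eq)
      hence "c\<^sup>2 = 3 * (4 * int m + 2 - 9 * d\<^sup>2) + 2" using less.prems 2 by (simp add: algebra_simps)
      thus ?thesis by presburger
    qed
    moreover have "c mod 3 = 0 \<or> c mod 3 = 1 \<or> c mod 3 = 2" by presburger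
    hence "(c mod 3)\<^sup>2 mod 3 \<noteq> 2" by auto
    ultimately show ?thesis by (simp add: power_mod)
  next
    case 3
    from inert_prime_dvd[OF p this less.prems] obtain c' d' where cd: "c = int p * c'" "d = int p * d'"
      by (auto elim!: dvdE)
    obtain j where j: "k = j + 2" using 3 by (metis le_add_diff_inverse2)
    have "(int p)\<^sup>2 * (c'\<^sup>2 + 27 * d'\<^sup>2) = (int p)\<^sup>2 * (4 * int p ^ j)"
      using less.prems by (simp add: cd j power_add power2_eq_square algebra_simps)
    hence "c'\<^sup>2 + 27 * d'\<^sup>2 = 4 * int p ^ j" using p by auto
    hence "d' = 0" using less.IH[of j] j by simp
    thus ?thesis using cd by simp
  qed
qed

section \<open>Counting modulo the characteristic\<close>

context noncubic_element
begin

text \<open>For nonzero \<open>t\<close>, \<open>t ^ f\<close> is a cube root of unity, so the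
  right-hand side is 3 if it is 1 and \<open>1 + w + w ^ 2 = 0\<close> otherwise.\<close>

lemma cube_roots_field: "(of_nat (cube_roots t) :: 'a) = 1 + t ^ f + t ^ (2 * f)"
proof (cases "t = 0")
  case True
  then show ?thesis using f_pos by (simp add: zero_power)
next
  case False
  have e: "t ^ (2 * f) = (t ^ f) ^ 2" by (simp add: mult.commute flip: power_mult)
  have w4: "(w ^ 2) ^ 2 = w"
  proof -
    have "(w ^ 2) ^ 2 = w ^ 3 * w" by (simp add: power2_eq_square power3_eq_cube)
    thus ?thesis by (simp only: w_cube mult_1_left)
  qed
  have "(t ^ f) ^ 3 = 1" using power_3f[OF False] by (simp add: mult.commute flip: power_mult)
  then consider "t ^ f = 1" | "t ^ f = w" | "t ^ f = w ^ 2" using cube_eq_1_cases by blast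
  then show ?thesis
  proof cases
    case 1
    then show ?thesis unfolding e by (simp add: cube_roots_nonzero[OF False])
  next
    case 2
    then show ?thesis using w_neq_1 w_quadratic unfolding e by (simp add: cube_roots_nonzero[OF False])
  next
    case 3
    have "1 + w ^ 2 + w = 0" using w_quadratic by (simp add: algebra_simps)
    then show ?thesis
      unfolding e 3 w4 using w_square_neq 3 by (simp add: cube_roots_nonzero[OF False])
  qed
qed

lemma minus_1_power_f: "(- 1 :: 'a) ^ f = 1"
proof -
  have "cubic (- 1 :: 'a)" unfolding cubic_def by (rule exI[of _ "- 1"]) simp
  thus ?thesis using cubic_iff[of "- 1"] by simp
qed

text \<open>Here \<open>3 * f\<close> is q - 1, so one reduction of the exponent by q - 1 suffices
  in this range.\<close>

lemma power_sum: "m < 6 * f \<Longrightarrow> (\<Sum>t\<in>UNIV. (t::'a) ^ m) = (if m = 3 * f then - 1 else 0)"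
proof -
  assume m: "m < 6 * f"
  consider "m < 3 * f" | "m = 3 * f" | j where "m = j + 3 * f" "0 < j" "j < 3 * f"
    using m by (metis add.commute add_less_cancel_left less_add_same_cancel1 less_imp_add_positive
        linorder_neqE_nat mult_2 mult.assoc mult_2_right num_double numeral_times_numeral)
  then show ?thesis
  proof cases
    case 1
    then show ?thesis using sum_power_eq_0[where 'a='a, of m] by (simp add: card_eq)
  next
    case 2
    then show ?thesis using sum_power_CARD_minus_1[where 'a='a] by (simp add: card_eq)
  next
    case 3
    then show ?thesis
      using sum_power_shift[where 'a='a, of j] sum_power_eq_0[where 'a='a, of j] by (simp add: card_eq)
  qed
qed

text \<open>In the binomial expansion of \<open>(b - t) ^ j\<close> only the term \<open>l\<close>
  with \<open>i + l = 3 * f\<close> survives, because all exponents are at most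
  \<open>4 * f\<close>. If \<open>3 * f - i\<close> exceeds \<open>j\<close>, the binomial
  coefficient is zero.\<close>

lemma mixed_moment:
  fixes b :: 'a
  assumes "i \<le> 2 * f" "j \<le> 2 * f"
  shows "(\<Sum>t\<in>UNIV. t ^ i * (b - t) ^ j)
    = - of_nat (j choose (3 * f - i)) * (- 1) ^ (3 * f - i) * b ^ (j - (3 * f - i))"
proof -
  have "(\<Sum>t\<in>UNIV. t ^ i * (b - t) ^ j)
      = (\<Sum>t\<in>UNIV. \<Sum>l\<le>j. of_nat (j choose l) * (- 1) ^ l * b ^ (j - l) * t ^ (i + l))"
  proof (intro sum.cong refl)
    fix t :: 'a
    have "(b - t) ^ j = (\<Sum>l\<le>j. of_nat (j choose l) * (- t) ^ l * b ^ (j - l))"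
      using binomial_ring[of "- t" b j] by simp
    thus "t ^ i * (b - t) ^ j = (\<Sum>l\<le>j. of_nat (j choose l) * (- 1) ^ l * b ^ (j - l) * t ^ (i + l))"
      by (simp add: sum_distrib_left power_add power_minus[of t] mult_ac)
  qed
  also have "\<dots> = (\<Sum>l\<le>j. of_nat (j choose l) * (- 1) ^ l * b ^ (j - l) * (\<Sum>t\<in>UNIV. t ^ (i + l)))"
    by (subst sum.swap) (simp add: sum_distrib_left)
  also have "\<dots> = (\<Sum>l\<le>j. if l = 3 * f - i
      then - of_nat (j choose (3 * f - i)) * (- 1) ^ (3 * f - i) * b ^ (j - (3 * f - i)) else 0)"
  proof (intro sum.cong refl)
    fix l assume "l \<in> {..j}"
    hence "i + l < 6 * f" using assms f_pos by simp
    moreover have "i + l = 3 * f \<longleftrightarrow> l = 3 * f - i" using assms by auto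
    ultimately show "of_nat (j choose l) * (- 1) ^ l * b ^ (j - l) * (\<Sum>t\<in>UNIV. t ^ (i + l))
        = (if l = 3 * f - i
      then - of_nat (j choose (3 * f - i)) * (- 1) ^ (3 * f - i) * b ^ (j - (3 * f - i)) else 0)"
      by (simp add: power_sum)
  qed
  also have "\<dots> = - of_nat (j choose (3 * f - i)) * (- 1) ^ (3 * f - i) * b ^ (j - (3 * f - i))"
    by (auto simp: not_le binomial_eq_0)
  finally show ?thesis .
qed

text \<open>Of the nine moments only those with \<open>i + j \<ge> 3 * f\<close> survive: the pairs
  (f, 2f) and (2f, f) give -1 each, and (2f, 2f) gives the binomial term.\<close>

lemma two_cubes_field: "(of_nat (two_cubes b) :: 'a) = - 2 - of_nat (2 * f choose f) * b ^ f"
proof -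
  let ?M = "\<lambda>i j. \<Sum>t\<in>UNIV. t ^ i * (b - t) ^ j"
  have "(of_nat (two_cubes b) :: 'a)
      = (\<Sum>t\<in>UNIV. (1 + t ^ f + t ^ (2 * f)) * (1 + (b - t) ^ f + (b - t) ^ (2 * f)))"
    by (simp add: two_cubes_def cube_roots_field)
  also have "\<dots> = ?M 0 0 + ?M 0 f + ?M 0 (2 * f) + ?M f 0 + ?M f f + ?M f (2 * f)
      + ?M (2 * f) 0 + ?M (2 * f) f + ?M (2 * f) (2 * f)"
    by (simp add: ring_distribs sum.distrib)
  also have "\<dots> = - 2 - of_nat (2 * f choose f) * b ^ f"
  proof -
    have M0: "?M i j = 0" if "i \<le> 2 * f" "j \<le> 2 * f" "i + j < 3 * f" for i j
      using that by (simp add: mixed_moment binomial_eq_0)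
    have "3 * f - f = 2 * f" "3 * f - 2 * f = f" by auto
    moreover have "(- 1 :: 'a) ^ (2 * f) = 1" by simp
    ultimately have M: "?M f (2 * f) = - 1" "?M (2 * f) f = - 1"
      "?M (2 * f) (2 * f) = - of_nat (2 * f choose f) * b ^ f"
      by (simp_all add: mixed_moment minus_1_power_f)
    have "?M 0 0 = 0" "?M 0 f = 0" "?M 0 (2 * f) = 0" "?M f 0 = 0" "?M f f = 0" "?M (2 * f) 0 = 0"
      using f_pos by (intro M0; simp)+
    then show ?thesis unfolding M by (simp only:) simp
  qed
  finally show ?thesis .
qed

lemma dev_field: "(of_int (dev i) :: 'a) = - of_nat (2 * f choose f) * w ^ i"
proof -
  have "(of_nat CARD('a) :: 'a) = 0"
    using CHAR_dvd_CARD[where 'a='a] by (simp add: of_nat_eq_0_iff_char_dvd)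
  hence "3 * of_nat f = (- 1 :: 'a)" unfolding card_eq by (simp add: eq_neg_iff_add_eq_0 add.commute)
  moreover have "(z ^ i) ^ f = w ^ i" by (simp add: mult.commute flip: power_mult)
  ultimately show ?thesis by (simp add: dev_def two_cubes_field)
qed

section \<open>Integrality and congruences of \<open>c\<^sub>0\<close> and
  \<open>d\<^sub>0\<close>\<close>

lemma nine_dvd_two_cubes:
  assumes "b \<noteq> (0::'a)" "b ^ f \<noteq> 1"
  shows "9 dvd two_cubes b"
  unfolding two_cubes_def
proof (rule dvd_sum)
  fix t :: 'a
  \<comment> \<open>Hence the terms \<open>t = 0\<close> and \<open>t = b\<close> vanish, and every
    other term is a product of two factors equal to 0 or 3.\<close>
  have "cube_roots b = 0" using assms by (simp add: cube_roots_nonzero)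
  then show "9 dvd cube_roots t * cube_roots (b - t)"
    by (cases "t = 0"; cases "b - t = 0") (auto simp: cube_roots_nonzero)
qed

lemma three_dvd_two_cubes:
  assumes "b \<noteq> (0::'a)"
  shows "3 dvd two_cubes b"
  unfolding two_cubes_def
proof (rule dvd_sum)
  fix t :: 'a
  show "3 dvd cube_roots t * cube_roots (b - t)"
    using assms by (cases "t = 0") (auto simp: cube_roots_nonzero)
qed

definition c\<^sub>0 :: int where "c\<^sub>0 = dev 0"
text \<open>The division is exact by \<open>nine_d\<close>.\<close>

definition d\<^sub>0 :: int where "d\<^sub>0 = (dev 1 - dev 2) div 9"

lemma nine_d: "9 * d\<^sub>0 = dev 1 - dev 2"
proof -
  have "(z ^ 2) ^ f = w ^ 2" by (simp add: mult.commute flip: power_mult)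
  hence "9 dvd two_cubes z" "9 dvd two_cubes (z ^ 2)"
    using z_nonzero w_neq_1 w_square_neq by (auto intro!: nine_dvd_two_cubes)
  hence "int 9 dvd int (two_cubes z)" "int 9 dvd int (two_cubes (z ^ 2))"
    unfolding int_dvd_int_iff by auto
  hence "9 dvd int (two_cubes z) - int (two_cubes (z ^ 2))" by (intro dvd_diff) auto
  thus ?thesis by (simp add: d\<^sub>0_def dev_def)
qed

lemma c_mod_3: "[c\<^sub>0 = 1] (mod 3)"
proof -
  have "int 3 dvd int (two_cubes (1::'a))" unfolding int_dvd_int_iff by (rule three_dvd_two_cubes) simp
  then obtain e where "int (two_cubes (1::'a)) = 3 * e" by auto
  hence "c\<^sub>0 = 1 + 3 * (e - int f)" by (simp add: c\<^sub>0_def dev_def)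
  thus ?thesis unfolding cong_def by presburger
qed

lemma dev_1: "2 * dev 1 = - c\<^sub>0 + 9 * d\<^sub>0"
  using dev_sum nine_d by (simp add: c\<^sub>0_def)

text \<open>Given \<open>dev_sum\<close>, completing the square in \<open>dev_e2\<close> shows that
  12q equals three times the square of \<open>dev 0\<close> plus the square of
  \<open>dev 1 - dev 2\<close>.\<close>

lemma norm_eq: "4 * int CARD('a) = c\<^sub>0\<^sup>2 + 27 * d\<^sub>0\<^sup>2"
proof -
  have d2: "dev 2 = - dev 0 - dev 1" using dev_sum by simp
  have "3 * (27 * d\<^sub>0\<^sup>2) = (9 * d\<^sub>0)\<^sup>2" by (simp add: power_mult_distrib)
  also have "\<dots> = 3 * (4 * int CARD('a) - c\<^sub>0\<^sup>2)"
  proof -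
    have q: "3 * int CARD('a) = - (dev 0 * dev 1 + dev 1 * dev 2 + dev 2 * dev 0)"
      using dev_e2 by linarith
    have "3 * (4 * int CARD('a) - c\<^sub>0\<^sup>2) = 4 * (3 * int CARD('a)) - 3 * (dev 0)\<^sup>2"
      by (simp add: c\<^sub>0_def)
    thus ?thesis unfolding q nine_d d2 by (simp add: algebra_simps power2_eq_square)
  qed
  finally show ?thesis by simp
qed

text \<open>In the field the three deviations are in the ratio of 1, \<open>w\<close>,
  \<open>w ^ 2\<close>, and \<open>w - w ^ 2 = 2 * w + 1\<close>.\<close>

lemma field_congruence: "of_int (9 * d\<^sub>0) = of_int c\<^sub>0 * (2 * w + 1)"
proof -
  have e: "w ^ 2 = - 1 - w" using w_quadratic by (simp add: algebra_simps eq_neg_iff_add_eq_0)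
  show ?thesis
    unfolding nine_d c\<^sub>0_def of_int_diff dev_field e by (simp add: ring_distribs)
qed

section \<open>The generating function\<close>

lemma excess_fps:
  "Abs_fps excess = - ((fps_const (Q - 1) * fps_X + fps_const (1 / 2 * (Q - 1) * (of_int c\<^sub>0 - 9 * of_int d\<^sub>0)) * fps_X ^ 2)
    / (1 - fps_const (3 * Q) * fps_X ^ 2 - fps_const (Q * of_int c\<^sub>0) * fps_X ^ 3))"
    (is "?A = - (?num / ?den)")
proof -
  have u1: "u 1 = - (of_int c\<^sub>0 - 9 * of_int d\<^sub>0) / 2"
  proof -
    have "rat_of_int (2 * dev 1) = rat_of_int (- c\<^sub>0 + 9 * d\<^sub>0)" by (simp only: dev_1)
    thus ?thesis by simp
  qed
  \<comment> \<open>From the third coefficient on this is \<open>excess_rec\<close>; the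
    coefficients 0, 1 and 2 come from \<open>excess_init\<close>.\<close>
  have "- ?A * ?den = ?num"
  proof (rule fps_ext)
    fix n
    have "- ?A * ?den = fps_const (3 * Q) * (fps_X ^ 2 * ?A) + fps_const (Q * of_int c\<^sub>0) * (fps_X ^ 3 * ?A) - ?A"
      by (simp add: algebra_simps)
    hence eq: "(- ?A * ?den) $ n = 3 * Q * (if n < 2 then 0 else excess (n - 2))
        + Q * of_int c\<^sub>0 * (if n < 3 then 0 else excess (n - 3)) - excess n"
      by (simp add: fps_X_power_mult_nth)
    consider "n = 0" | "n = 1" | "n = 2" | m where "n = m + 3"
      by (metis One_nat_def Suc_1 add.commute le_add_diff_inverse less_2_cases not_less_eq_eq numeral_3_eq_3 not_less nat_less_le)
    then show "(- ?A * ?den) $ n = ?num $ n"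
    proof cases
      case 1
      then show ?thesis unfolding eq using excess_init by simp
    next
      case 2
      then show ?thesis unfolding eq using excess_init by simp
    next
      case 3
      then show ?thesis unfolding eq using excess_init by (simp add: u1[unfolded One_nat_def] fps_X_power_nth field_simps)
    next
      case 4
      then show ?thesis unfolding eq using excess_rec[of m] by (simp add: c\<^sub>0_def fps_X_power_nth)
    qed
  qed
  moreover have "?den \<noteq> 0"
  proof
    assume "?den = 0"
    hence "?den $ 0 = 0 $ 0" by (simp only:)
    thus False by simp
  qed
  ultimately have "?num / ?den = - ?A" by (metis nonzero_mult_div_cancel_right)
  thus ?thesis by simp
qed

lemma B_fps:
  "Abs_fps (\<lambda>n. of_nat (B n z)) = 1 / (1 - fps_const Q * fps_X)
    - (fps_const (Q - 1) * fps_X + fps_const (1 / 2 * (Q - 1) * (of_int c\<^sub>0 - 9 * of_int d\<^sub>0)) * fps_X ^ 2)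
    / (1 - fps_const (3 * Q) * fps_X ^ 2 - fps_const (Q * of_int c\<^sub>0) * fps_X ^ 3)"
proof -
  let ?G = "Abs_fps (\<lambda>n. Q ^ n)"
  have "?G * (1 - fps_const Q * fps_X) = 1"
  proof (rule fps_ext)
    fix n
    have "?G * (1 - fps_const Q * fps_X) = ?G - fps_const Q * (fps_X * ?G)" by (simp add: algebra_simps)
    thus "(?G * (1 - fps_const Q * fps_X)) $ n = 1 $ n" by (cases n) simp_all
  qed
  moreover have "1 - fps_const Q * fps_X \<noteq> 0"
  proof
    assume "1 - fps_const Q * fps_X = 0"
    hence "(1 - fps_const Q * fps_X) $ 0 = 0 $ 0" by (simp only:)
    thus False by simp
  qed
  ultimately have G: "?G = 1 / (1 - fps_const Q * fps_X)" by (metis nonzero_mult_div_cancel_right)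
  have "Abs_fps (\<lambda>n. of_nat (B n z)) = ?G + Abs_fps excess"
    by (rule fps_ext) (simp add: B_eq_excess)
  thus ?thesis unfolding G excess_fps by simp
qed

end

theorem theorem1p5:
  fixes p k q :: nat and z :: "'a::{field,finite}"
  assumes "prime p" and "k \<ge> 1" and "q = p ^ k" and "CARD('a) = q"
    and "[q = 1] (mod 3)"
    and "z \<noteq> 0" and "\<not> cubic z"
  shows "(z ^ ((q - 1) div 3)) ^ 3 = 1
    \<and> ([p = 1] (mod 3) \<longrightarrow> z ^ ((q - 1) div 3) \<in> range (of_int :: int \<Rightarrow> 'a))
    \<and> (\<exists>!cd. is_cd p z (fst cd) (snd cd))
    \<and> (\<forall>c d. is_cd p z c d \<longrightarrow>
        (Abs_fps (\<lambda>n. of_nat (B n z)) :: rat fps) =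
          1 / (1 - fps_const (of_nat q) * fps_X)
          - (fps_const (of_nat q - 1) * fps_X
             + fps_const (1 / 2 * (of_nat q - 1) * (of_int c - 9 * of_int d)) * fps_X ^ 2)
            / (1 - fps_const (3 * of_nat q) * fps_X ^ 2
                 - fps_const (of_nat q * of_int c) * fps_X ^ 3))"
proof -
  define f where "f = (q - 1) div 3"
  have q3: "q mod 3 = 1" using assms(5) by (simp add: cong_def)
  hence q: "q = 3 * f + 1" unfolding f_def by presburger
  interpret noncubic_element z f
    using assms q by unfold_locales auto
  have charp: "CHAR('a) = p"
  proof -
    have "CHAR('a) > 0" by (rule finite_imp_CHAR_pos) simp
    hence pr: "prime CHAR('a)" by (rule prime_CHAR_semidom)
    moreover have "CHAR('a) dvd p ^ k" using CHAR_dvd_CARD[where 'a='a] assms by simp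
    ultimately show ?thesis using assms(1) by (metis prime_dvd_power primes_dvd_imp_eq)
  qed
  have int_q: "int CARD('a) = int p ^ k" using assms by simp
  have Q: "Q = of_nat q" by (simp add: Q_def q)
  have p3: "p mod 3 = 1 \<or> p mod 3 = 2"
  proof -
    have "p mod 3 \<noteq> 0"
    proof
      assume "p mod 3 = 0"
      hence "3 dvd q" using assms(2,3) by (metis dvd_power dvd_trans mod_0_imp_dvd less_le_trans zero_less_one)
      thus False using q3 by presburger
    qed
    thus ?thesis by presburger
  qed
  \<comment> \<open>In the field \<open>c\<^sub>0\<close> is minus the binomial coefficient
    \<open>2 * f choose f\<close>.\<close>
  have cop: "coprime c\<^sub>0 (int p)" if "[p = 1] (mod 3)"
  proof -
    have "p = 3 * (p div 3) + 1" using that unfolding cong_def by presburger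
    hence "(of_nat ((2 * f) choose f) :: 'a) \<noteq> 0"
      using assms q charp by (intro central_binomial_nonzero[of "p div 3" k]) auto
    hence "(of_int c\<^sub>0 :: 'a) \<noteq> 0" by (simp add: c\<^sub>0_def dev_field)
    hence "\<not> int p dvd c\<^sub>0" using charp by (simp add: of_int_eq_0_iff_char_dvd)
    thus ?thesis using assms(1) by (metis coprime_commute prime_imp_coprime prime_nat_int_transfer)
  qed
  have ex: "is_cd p z c\<^sub>0 d\<^sub>0"
    unfolding is_cd_def using norm_eq c_mod_3 cop field_congruence by (simp add: card_eq)
  have uniq: "c = c\<^sub>0 \<and> d = d\<^sub>0" if cd: "is_cd p z c d" for c d
  proof -
    have n: "c\<^sup>2 + 27 * d\<^sup>2 = 4 * int p ^ k" "[c = 1] (mod 3)"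
      and n0: "c\<^sub>0\<^sup>2 + 27 * d\<^sub>0\<^sup>2 = 4 * int p ^ k"
      using cd norm_eq unfolding is_cd_def int_q by auto
    show ?thesis
    proof (cases "p mod 3 = 1")
      case True
      hence p1: "[p = 1] (mod 3)" by (simp add: cong_def)
      have p': "p \<noteq> 2" "p \<noteq> 3" using True by auto
      have e: "of_int (9 * d) = of_int c * (2 * w + 1)" "of_int (9 * d\<^sub>0) = of_int c\<^sub>0 * (2 * w + 1)"
        using cd ex unfolding is_cd_def by (simp_all add: card_eq)
      \<comment> \<open>Eliminating \<open>w\<close> from the two congruences gives the divisibility
        needed for \<open>representation_unique_split\<close>.\<close>
      have "of_int (9 * (c * d\<^sub>0 - c\<^sub>0 * d)) = of_int c * of_int (9 * d\<^sub>0) - of_int c\<^sub>0 * (of_int (9 * d) :: 'a)"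
        by (simp add: algebra_simps)
      also have "\<dots> = 0" unfolding e by (simp add: algebra_simps)
      finally have "int p dvd 9 * (c * d\<^sub>0 - c\<^sub>0 * d)"
        using charp by (simp only: of_int_eq_0_iff_char_dvd)
      moreover have "\<not> int p dvd 9"
      proof
        assume "int p dvd 9"
        hence "int p dvd 3 ^ 2" by simp
        hence "int p dvd 3" using assms(1) by (metis prime_dvd_power prime_nat_int_transfer)
        thus False using assms(1) p' primes_dvd_imp_eq[of "int p" 3] by auto
      qed
      ultimately have "int p dvd c * d\<^sub>0 - c\<^sub>0 * d"
        using assms(1) by (metis prime_dvd_mult_iff prime_nat_int_transfer)
      thus ?thesis
        using cd p1 cop n n0 c_mod_3 assms(1,2) p'
        by (intro representation_unique_split[of "int p" c d k]) (auto simp: is_cd_def)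
    next
      case False
      hence p2: "p mod 3 = 2" using p3 by simp
      have d: "d = 0" "d\<^sub>0 = 0"
        using representation_inert[OF assms(1) p2 n(1)] representation_inert[OF assms(1) p2 n0] by auto
      hence "c\<^sup>2 = c\<^sub>0\<^sup>2" using n n0 by simp
      thus ?thesis using eq_of_squares_eq_mod_3[OF _ n(2) c_mod_3] d by simp
    qed
  qed
  have range: "w \<in> range (of_int :: int \<Rightarrow> 'a)" if p1: "[p = 1] (mod 3)"
  proof -
    have "p \<noteq> 2" using p1 by (auto simp: cong_def)
    hence "odd p" using prime_odd_nat[OF assms(1)] prime_ge_2_nat[OF assms(1)] by simp
    hence "coprime 2 (int p)" by simp
    hence "coprime (2 * c\<^sub>0) (int p)" using cop[OF p1] by simp
    \<comment> \<open>With \<open>2 * c\<^sub>0\<close> invertible modulo p,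
      \<open>field_congruence\<close> can be solved for \<open>w\<close> within the prime
      field.\<close>
    then obtain e where e: "[2 * c\<^sub>0 * e = 1] (mod int p)" using cong_solve_coprime_int by blast
    have "(of_int (2 * c\<^sub>0 * e) :: 'a) = of_int 1"
      using e charp by (simp only: of_int_eq_iff_cong_CHAR)
    hence "w = of_int (2 * c\<^sub>0 * e) * w" by (simp only: of_int_1 mult_1_left)
    also have "\<dots> = of_int e * (of_int c\<^sub>0 * (2 * w + 1) - of_int c\<^sub>0)"
      by (simp add: algebra_simps)
    also have "\<dots> = of_int (e * (9 * d\<^sub>0 - c\<^sub>0))"
      by (simp only: field_congruence[symmetric] of_int_mult of_int_diff)
    finally show ?thesis by (rule range_eqI)
  qed
  have "\<exists>!cd. is_cd p z (fst cd) (snd cd)"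
  proof (rule ex1I)
    show "is_cd p z (fst (c\<^sub>0, d\<^sub>0)) (snd (c\<^sub>0, d\<^sub>0))" using ex by simp
    show "cd = (c\<^sub>0, d\<^sub>0)" if "is_cd p z (fst cd) (snd cd)" for cd
      using uniq[OF that] by (simp only: prod_eq_iff fst_conv snd_conv)
  qed
  then show ?thesis
    unfolding f_def[symmetric]
  proof (intro conjI allI impI)
    fix c d assume "is_cd p z c d"
    then have "c = c\<^sub>0" "d = d\<^sub>0" using uniq by auto
    then show "(Abs_fps (\<lambda>n. of_nat (B n z)) :: rat fps) =
          1 / (1 - fps_const (of_nat q) * fps_X)
          - (fps_const (of_nat q - 1) * fps_X
             + fps_const (1 / 2 * (of_nat q - 1) * (of_int c - 9 * of_int d)) * fps_X ^ 2)
            / (1 - fps_const (3 * of_nat q) * fps_X ^ 2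
                 - fps_const (of_nat q * of_int c) * fps_X ^ 3)"
      by (simp only: B_fps Q)
  qed (use w_cube range in blast)+
qed

end
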